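(* There exists $n_0>0$ such that for all $n\ge n_0$ and all $k\ge 65\log{n}$ the following holds: if $G$ is an $n$-vertex graph with $\delta_2(G)\ge k$, then $G$ is $\lfloor k/40\rfloor$-rigid.
   Context: For a graph $G=(V,E)$ and distinct $u,v\in V$, $d_2(u,v)=|N_G(u)\cap N_G(v)|$ is the number of common neighbours, and the minimum codegree $\delta_2(G)$ is the minimum of $d_2(u,v)$ over all pairs of distinct $u,v\in V$. A $d$-dimensional framework $(G,\mathbf{p})$, $\mathbf{p}:V\to\mathbb{R}^d$, is rigid if every continuous edge-length-preserving motion of the vertices starting at $\mathbf{p}$ preserves all pairwise distances; $\mathbf{p}$ is generic if its $d|V|$ coordinates are algebraically independent over $\mathbb{Q}$; $G$ is $d$-rigid if $(G,\mathbf{p})$ is rigid for some (equivalently, every) generic $\mathbf{p}$. $\log$ is the natural logarithm. *)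

theory Defs
  imports
    "HOL-Analysis.Analysis"
    "HOL-Library.Poly_Mapping"
    "Graph_Theory.Pair_Digraph"
begin

text \<open>
  A finite simple graph is a \<open>pair_graph\<close>: a finite, loopless, symmetric digraph without
  parallel arcs, where an edge \<open>uv\<close> is represented by the two arcs \<open>(u, v)\<close> and \<open>(v, u)\<close>.
\<close>

definition neighbourhood :: "'a pair_pre_digraph \<Rightarrow> 'a \<Rightarrow> 'a set" where
  "neighbourhood G u = {w. (u, w) \<in> parcs G}"

definition codegree :: "'a pair_pre_digraph \<Rightarrow> 'a \<Rightarrow> 'a \<Rightarrow> nat" where
  "codegree G u v = card (neighbourhood G u \<inter> neighbourhood G v)"

text \<open>The minimum is unspecified for graphs with fewer than two vertices.\<close>

definition min_codegree :: "'a pair_pre_digraph \<Rightarrow> nat" where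
  "min_codegree G = Min {codegree G u v | u v. u \<in> pverts G \<and> v \<in> pverts G \<and> u \<noteq> v}"

text \<open>
  Since the dimension \<open>d\<close> varies inside a statement, a point of d-dimensional Euclidean space
  is a function \<open>nat \<Rightarrow> real\<close> of which only the values at indices below \<open>d\<close> matter.
\<close>

definition dist_in :: "nat \<Rightarrow> (nat \<Rightarrow> real) \<Rightarrow> (nat \<Rightarrow> real) \<Rightarrow> real" where
  "dist_in d x y = L2_set (\<lambda>i. x i - y i) {..<d}"

definition continuous_motion ::
  "nat \<Rightarrow> 'a pair_pre_digraph \<Rightarrow> ('a \<Rightarrow> nat \<Rightarrow> real) \<Rightarrow> (real \<Rightarrow> 'a \<Rightarrow> nat \<Rightarrow> real) \<Rightarrow> bool" where
  "continuous_motion d G p m \<longleftrightarrow>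
     (\<forall>v\<in>pverts G. \<forall>i<d. continuous_on {0..1} (\<lambda>t. m t v i)) \<and>
     (\<forall>v\<in>pverts G. \<forall>i<d. m 0 v i = p v i)"

definition rigid_framework ::
  "nat \<Rightarrow> 'a pair_pre_digraph \<Rightarrow> ('a \<Rightarrow> nat \<Rightarrow> real) \<Rightarrow> bool" where
  "rigid_framework d G p \<longleftrightarrow>
     (\<forall>m. continuous_motion d G p m \<and>
          (\<forall>t\<in>{0..1}. \<forall>(u, v)\<in>parcs G. dist_in d (m t u) (m t v) = dist_in d (p u) (p v)) \<longrightarrow>
          (\<forall>t\<in>{0..1}. \<forall>u\<in>pverts G. \<forall>v\<in>pverts G.
             dist_in d (m t u) (m t v) = dist_in d (p u) (p v)))"

text \<open>
  Multivariate polynomials over the rationals with variables in \<open>'x\<close> are finitely supported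
  maps from monomials (finitely supported exponent vectors \<open>'x \<Rightarrow>\<^sub>0 nat\<close>) to coefficients.
\<close>

definition eval_rat_poly :: "('x \<Rightarrow> real) \<Rightarrow> (('x \<Rightarrow>\<^sub>0 nat) \<Rightarrow>\<^sub>0 rat) \<Rightarrow> real" where
  "eval_rat_poly f P =
     (\<Sum>m\<in>Poly_Mapping.keys P. real_of_rat (Poly_Mapping.lookup P m)
        * (\<Prod>x\<in>Poly_Mapping.keys m. f x ^ Poly_Mapping.lookup m x))"

definition rat_poly_vars :: "(('x \<Rightarrow>\<^sub>0 nat) \<Rightarrow>\<^sub>0 rat) \<Rightarrow> 'x set" where
  "rat_poly_vars P = (\<Union>m\<in>Poly_Mapping.keys P. Poly_Mapping.keys m)"

definition algebraically_independent_over_rat :: "'x set \<Rightarrow> ('x \<Rightarrow> real) \<Rightarrow> bool" where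
  "algebraically_independent_over_rat I f \<longleftrightarrow>
     (\<forall>P. rat_poly_vars P \<subseteq> I \<and> eval_rat_poly f P = 0 \<longrightarrow> P = 0)"

definition generic :: "nat \<Rightarrow> 'a pair_pre_digraph \<Rightarrow> ('a \<Rightarrow> nat \<Rightarrow> real) \<Rightarrow> bool" where
  "generic d G p \<longleftrightarrow>
     algebraically_independent_over_rat (pverts G \<times> {..<d}) (\<lambda>(v, i). p v i)"

definition rigid_graph :: "nat \<Rightarrow> 'a pair_pre_digraph \<Rightarrow> bool" where
  "rigid_graph d G \<longleftrightarrow> (\<exists>p. generic d G p \<and> rigid_framework d G p)"

end

theory Submission
  imports Defs
begin

text \<open>
  Map the vertices at random to \<open>m = 6d\<close> classes. By a union bound, for every pair of vertices
  the common neighbours meet at least \<open>5d\<close> classes. Place each vertex at a generic point that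
  depends only on its class. An infinitesimal motion is then constant on every class, because two
  vertices of a class have common neighbours in more than \<open>d\<close> generic directions, so it is a
  motion of the quotient graph, in which every class misses at most \<open>d\<close> others.

  Such a dense quotient \<open>H\<close> is infinitesimally rigid at generic points \<open>x c\<close> by counting
  parameters. A motion \<open>f\<close> gives the symmetric matrix
  \<open>M c c' = (f c - f c') \<bullet> (x c - x c')\<close>, which vanishes on the edges of \<open>H\<close> and on the diagonal
  and has the form \<open>P B\<^sup>T + B P\<^sup>T\<close>, where the rows of \<open>P\<close> are homogeneous coordinates of the points.
  If \<open>M\<close> has rank \<open>r > 0\<close>, its column space is described by at most \<open>r d\<close> nonzero entries and
  meets that of \<open>P\<close> in dimension at least \<open>r / 2\<close>. This expresses the algebraically independent
  entries of \<open>P\<close> through fewer numbers, a contradiction; so \<open>M = 0\<close> and \<open>f\<close> is trivial.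

  Infinitesimal rigidity persists at nearby points, some of which are generic, and implies
  rigidity.
\<close>

section \<open>Linear systems over finite index sets\<close>

text \<open>Collapsing pays because it leaves at most \<open>6 d\<close> points and an almost
  complete graph on them, for which a crude count suffices. If the two column spaces meet in
  dimension \<open>r2 \<ge> r / 2\<close>, the count trades \<open>r2\<close> columns of
  \<open>P\<close>, with one entry per class, for at most \<open>2 r2 d\<close> entries of
  \<open>M\<close>, at most \<open>r2 r2\<close> coefficients and \<open>r2 (d + 1)\<close>
  coordinates. As \<open>r2 \<le> d + 1\<close>, it succeeds once there are more than
  \<open>4 d + 2\<close> classes. At least \<open>5 d\<close> classes and \<open>d \<ge> 3\<close>
  secure this. The price is the union bound, whose exponent
  \<open>2 k / 65 + 5 k / 48 - k / 6\<close> is negative.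

  The count needs \<open>d + 1\<close> independent coordinates per class, whereas the homogeneous
  coordinates of a point end in 1. Generic vectors are therefore chosen first and then scaled to
  last entry 1; scaling the rows of \<open>P\<close> scales the entries of \<open>M\<close> and
  keeps its zeros.

  Vertices of one class coincide, so the collapsed placement is far from generic for the graph
  itself. It serves only as the centre of a perturbation.\<close>

definition real_subfield :: "real set \<Rightarrow> bool" where
  "real_subfield K \<longleftrightarrow> 0 \<in> K \<and> 1 \<in> K \<and>
     (\<forall>x\<in>K. \<forall>y\<in>K. x + y \<in> K \<and> x * y \<in> K) \<and> (\<forall>x\<in>K. - x \<in> K \<and> inverse x \<in> K)"

lemma real_subfieldD:
  assumes "real_subfield K"
  shows "0 \<in> K" "1 \<in> K" "x \<in> K \<Longrightarrow> y \<in> K \<Longrightarrow> x + y \<in> K" "x \<in> K \<Longrightarrow> y \<in> K \<Longrightarrow> x * y \<in> K"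
    "x \<in> K \<Longrightarrow> - x \<in> K" "x \<in> K \<Longrightarrow> inverse x \<in> K"
  using assms by (auto simp: real_subfield_def)

lemma real_subfield_diff:
  "real_subfield K \<Longrightarrow> x \<in> K \<Longrightarrow> y \<in> K \<Longrightarrow> x - y \<in> K"
  using real_subfieldD(3)[of K x "- y"] real_subfieldD(5)[of K y] by simp

lemma real_subfield_divide:
  "real_subfield K \<Longrightarrow> x \<in> K \<Longrightarrow> y \<in> K \<Longrightarrow> x / y \<in> K"
  using real_subfieldD(4)[of K x "inverse y"] real_subfieldD(6)[of K y] by (simp add: divide_inverse)

lemma real_subfield_sum:
  assumes "real_subfield K" "\<And>x. x \<in> A \<Longrightarrow> f x \<in> K"
  shows "sum f A \<in> K"
  using assms(2) by (induction A rule: infinite_finite_induct) (auto simp: real_subfieldD[OF assms(1)])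

lemma real_subfield_UNIV: "real_subfield UNIV"
  by (simp add: real_subfield_def)

text \<open>Gaussian elimination, one equation at a time and by field operations only, so that the
  solution stays in \<open>K\<close>. This matters later, when unknowns must be rational functions
  of chosen parameters.\<close>

lemma underdetermined_solution:
  fixes A :: "'i \<Rightarrow> 'j \<Rightarrow> real"
  assumes K: "real_subfield K" and "finite I" "finite J" "card I < card J"
    and "\<And>i j. i \<in> I \<Longrightarrow> j \<in> J \<Longrightarrow> A i j \<in> K"
  obtains x where "\<And>j. j \<in> J \<Longrightarrow> x j \<in> K" "\<exists>j\<in>J. x j \<noteq> 0" "\<And>i. i \<in> I \<Longrightarrow> (\<Sum>j\<in>J. A i j * x j) = 0"
proof -
  have "\<exists>x. (\<forall>j\<in>J. x j \<in> K) \<and> (\<exists>j\<in>J. x j \<noteq> 0) \<and> (\<forall>i\<in>I. (\<Sum>j\<in>J. A i j * x j) = 0)"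
    using assms(2-)
  proof (induction I arbitrary: A J rule: finite_induct)
    case empty
    then have "J \<noteq> {}" by auto
    then show ?case by (intro exI[of _ "\<lambda>_. 1"]) (auto simp: real_subfieldD[OF K])
  next
    case (insert i0 I)
    show ?case
    proof (cases "\<forall>j\<in>J. A i0 j = 0")
      case True
      have "\<exists>x. (\<forall>j\<in>J. x j \<in> K) \<and> (\<exists>j\<in>J. x j \<noteq> 0) \<and> (\<forall>i\<in>I. (\<Sum>j\<in>J. A i j * x j) = 0)"
        using insert.prems insert.hyps by (intro insert.IH) auto
      then show ?thesis using True by auto
    next
      case False
      then obtain j0 where j0: "j0 \<in> J" "A i0 j0 \<noteq> 0" by auto
      define J' where "J' = J - {j0}"
      define A' where "A' i j = A i j - A i j0 * A i0 j / A i0 j0" for i j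
      have J: "J = insert j0 J'" "j0 \<notin> J'" "finite J'" "card I < card J'"
        using j0 insert.prems insert.hyps by (auto simp: J'_def)
      have "\<exists>x. (\<forall>j\<in>J'. x j \<in> K) \<and> (\<exists>j\<in>J'. x j \<noteq> 0) \<and> (\<forall>i\<in>I. (\<Sum>j\<in>J'. A' i j * x j) = 0)"
        using insert.prems j0 J
        by (intro insert.IH) (auto simp: A'_def intro!: real_subfield_diff[OF K] real_subfield_divide[OF K] real_subfieldD[OF K])
      then obtain x where x: "\<And>j. j\<in>J' \<Longrightarrow> x j \<in> K" "\<exists>j\<in>J'. x j \<noteq> 0"
        "\<And>i. i\<in>I \<Longrightarrow> (\<Sum>j\<in>J'. A' i j * x j) = 0" by auto
      define s where "s = (\<Sum>j\<in>J'. A i0 j * x j)"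
      define y where "y = x(j0 := - s / A i0 j0)"
      have split: "(\<Sum>j\<in>J. A i j * y j) = A i j0 * (- s / A i0 j0) + (\<Sum>j\<in>J'. A i j * x j)" for i
      proof -
        have "(\<Sum>j\<in>J'. A i j * y j) = (\<Sum>j\<in>J'. A i j * x j)"
          using J(2) by (intro sum.cong) (auto simp: y_def)
        then show ?thesis using J by (simp add: y_def)
      qed
      have "(\<Sum>j\<in>J. A i j * y j) = 0" if "i \<in> I" for i
      proof -
        have "0 = (\<Sum>j\<in>J'. A i j * x j - (A i j0 / A i0 j0) * (A i0 j * x j))"
          using x(3)[OF that] by (simp add: A'_def algebra_simps)
        also have "\<dots> = (\<Sum>j\<in>J'. A i j * x j) - (A i j0 / A i0 j0) * s"
          by (simp add: sum_subtractf sum_distrib_left s_def)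
        finally show ?thesis by (simp add: split)
      qed
      moreover have "(\<Sum>j\<in>J. A i0 j * y j) = 0"
        using j0 by (simp add: split s_def)
      moreover have "s \<in> K"
        unfolding s_def using insert.prems x(1) J(1)
        by (intro real_subfield_sum[OF K] real_subfieldD(4)[OF K]) auto
      then have "- s / A i0 j0 \<in> K"
        using insert.prems j0 by (intro real_subfield_divide[OF K] real_subfieldD(5)[OF K]) auto
      then have "\<forall>j\<in>J. y j \<in> K" using x(1) J by (auto simp: y_def)
      moreover have "\<exists>j\<in>J. y j \<noteq> 0" using x(2) J by (auto simp: y_def)
      ultimately show ?thesis by (intro exI[of _ y]) auto
    qed
  qed
  with that show thesis by blast
qed

text \<open>The columns indexed by \<open>J\<close> are linearly independent. Finite index sets
  replace matrix types because the dimension \<open>d\<close> varies inside the statement; maximal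
  independent families of columns are then plain subsets.\<close>

definition lin_inj :: "'i set \<Rightarrow> 'j set \<Rightarrow> ('i \<Rightarrow> 'j \<Rightarrow> real) \<Rightarrow> bool" where
  "lin_inj I J A \<longleftrightarrow> (\<forall>x. (\<forall>i\<in>I. (\<Sum>j\<in>J. A i j * x j) = 0) \<longrightarrow> (\<forall>j\<in>J. x j = 0))"

lemma lin_injD:
  assumes "lin_inj I J A" "\<And>i. i \<in> I \<Longrightarrow> (\<Sum>j\<in>J. A i j * x j) = 0" "j \<in> J"
  shows "x j = 0"
  using assms unfolding lin_inj_def by blast

lemma lin_injI:
  assumes "\<And>x j. (\<And>i. i \<in> I \<Longrightarrow> (\<Sum>j\<in>J. A i j * x j) = 0) \<Longrightarrow> j \<in> J \<Longrightarrow> x j = 0"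
  shows "lin_inj I J A"
  using assms unfolding lin_inj_def by blast

lemma lin_inj_card_le:
  assumes "lin_inj I J A" "finite I" "finite J"
  shows "card J \<le> card I"
proof (rule ccontr)
  assume "\<not> ?thesis"
  then have "card I < card J" by simp
  then obtain x where "\<exists>j\<in>J. x j \<noteq> 0" "\<And>i. i \<in> I \<Longrightarrow> (\<Sum>j\<in>J. A i j * x j) = 0"
    using underdetermined_solution[OF real_subfield_UNIV assms(2,3), of A] by auto
  then show False using lin_injD[OF assms(1)] by blast
qed

text \<open>With the right-hand side as an extra column \<open>None\<close>, the square system has
  more unknowns than equations. Injectivity forces the coefficient of that column to be nonzero, and
  dividing by it gives the solution.\<close>

lemma lin_inj_solution_subfield:
  assumes K: "real_subfield K" and fin: "finite I" "finite J" and card: "card I = card J"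
    and A: "\<And>i j. i \<in> I \<Longrightarrow> j \<in> J \<Longrightarrow> A i j \<in> K" and b: "\<And>i. i \<in> I \<Longrightarrow> b i \<in> K"
    and inj: "lin_inj I J A"
  obtains x where "\<And>j. j \<in> J \<Longrightarrow> x j \<in> K" "\<And>i. i \<in> I \<Longrightarrow> (\<Sum>j\<in>J. A i j * x j) = b i"
proof -
  define J' where "J' = insert None (Some ` J)"
  define A' where "A' i j = (case j of None \<Rightarrow> - b i | Some j \<Rightarrow> A i j)" for i j
  have c: "card I < card J'" using fin card by (simp add: J'_def card_insert_if card_image)
  have fin': "finite J'" using fin by (simp add: J'_def)
  have AK: "A' i j \<in> K" if "i \<in> I" "j \<in> J'" for i j
    using that A b by (auto simp: J'_def A'_def real_subfieldD(5)[OF K])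
  obtain z where z: "\<And>j. j \<in> J' \<Longrightarrow> z j \<in> K" "\<exists>j\<in>J'. z j \<noteq> 0"
      "\<And>i. i \<in> I \<Longrightarrow> (\<Sum>j\<in>J'. A' i j * z j) = 0"
    using underdetermined_solution[where A = A', OF K fin(1) fin' c AK] by blast
  have eq: "(\<Sum>j\<in>J. A i j * z (Some j)) = b i * z None" if "i \<in> I" for i
  proof -
    have "(\<Sum>j\<in>J'. A' i j * z j) = - b i * z None + (\<Sum>j\<in>J. A i j * z (Some j))"
      using fin by (simp add: J'_def A'_def sum.reindex)
    then show ?thesis using z(3)[OF that] by simp
  qed
  have nz: "z None \<noteq> 0"
  proof
    assume "z None = 0"
    then have "z (Some j) = 0" if "j \<in> J" for j
      using lin_injD[OF inj, of "\<lambda>j. z (Some j)"] eq that by auto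
    then show False using z(2) \<open>z None = 0\<close> by (auto simp: J'_def)
  qed
  show thesis
  proof (rule that[of "\<lambda>j. z (Some j) / z None"])
    show "z (Some j) / z None \<in> K" if "j \<in> J" for j
      using that z(1) by (intro real_subfield_divide[OF K]) (auto simp: J'_def)
    show "(\<Sum>j\<in>J. A i j * (z (Some j) / z None)) = b i" if "i \<in> I" for i
      using eq[OF that] nz by (simp add: sum_divide_distrib[symmetric])
  qed
qed

lemmas lin_inj_solution = lin_inj_solution_subfield[OF real_subfield_UNIV, simplified]

text \<open>\<open>x\<close> is not assumed to lie in \<open>K\<close>; uniqueness identifies it
  with the solution found inside \<open>K\<close>. This is how entries of a generic matrix are
  recovered from fewer parameters.\<close>

lemma lin_inj_unique_in_subfield:
  assumes K: "real_subfield K" and fin: "finite I" "finite J" and card: "card I = card J"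
    and A: "\<And>i j. i \<in> I \<Longrightarrow> j \<in> J \<Longrightarrow> A i j \<in> K"
    and inj: "lin_inj I J A" and x: "\<And>i. i \<in> I \<Longrightarrow> (\<Sum>j\<in>J. A i j * x j) \<in> K" and "j \<in> J"
  shows "x j \<in> K"
proof -
  obtain y where y: "\<And>j. j \<in> J \<Longrightarrow> y j \<in> K"
      "\<And>i. i \<in> I \<Longrightarrow> (\<Sum>j\<in>J. A i j * y j) = (\<Sum>j\<in>J. A i j * x j)"
    using lin_inj_solution_subfield[where A = A and b = "\<lambda>i. \<Sum>j\<in>J. A i j * x j", OF K fin card A x inj] by blast
  have "x j - y j = 0"
    by (rule lin_injD[OF inj _ \<open>j \<in> J\<close>]) (simp add: y(2) right_diff_distrib sum_subtractf)
  then show ?thesis using y(1)[OF \<open>j \<in> J\<close>] by simp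
qed

text \<open>The Gram matrix \<open>Q\<close> of the columns is invertible, since its quadratic form
  is a sum of squares; the left inverse is the inverse of \<open>Q\<close> times the transpose of
  \<open>A\<close>.\<close>

lemma lin_inj_left_inverse:
  assumes fin: "finite I" "finite J" and inj: "lin_inj I J A"
  obtains L :: "'j \<Rightarrow> 'i \<Rightarrow> real"
    where "\<And>j j'. j \<in> J \<Longrightarrow> j' \<in> J \<Longrightarrow> (\<Sum>i\<in>I. L j i * A i j') = (if j = j' then 1 else 0)"
proof -
  define Q where "Q j j' = (\<Sum>i\<in>I. A i j * A i j')" for j j'
  have Q: "(\<Sum>j'\<in>J. Q j j' * x j') = (\<Sum>i\<in>I. A i j * (\<Sum>j'\<in>J. A i j' * x j'))" for j x
    unfolding Q_def sum_distrib_right sum_distrib_left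
    by (subst sum.swap) (simp add: mult.assoc)
  have injQ: "lin_inj J J Q"
  proof (rule lin_injI)
    fix x j assume x: "\<And>j. j \<in> J \<Longrightarrow> (\<Sum>j'\<in>J. Q j j' * x j') = 0" and "j \<in> J"
    have "0 = (\<Sum>j\<in>J. x j * (\<Sum>j'\<in>J. Q j j' * x j'))" using x by simp
    also have "\<dots> = (\<Sum>j\<in>J. \<Sum>i\<in>I. x j * A i j * (\<Sum>j'\<in>J. A i j' * x j'))"
      by (simp add: Q sum_distrib_left mult.assoc)
    also have "\<dots> = (\<Sum>i\<in>I. \<Sum>j\<in>J. x j * A i j * (\<Sum>j'\<in>J. A i j' * x j'))" by (rule sum.swap)
    also have "\<dots> = (\<Sum>i\<in>I. (\<Sum>j\<in>J. A i j * x j)\<^sup>2)"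
      by (simp add: sum_distrib_right[symmetric] power2_eq_square mult.commute)
    finally have "\<forall>i\<in>I. (\<Sum>j\<in>J. A i j * x j)\<^sup>2 = 0"
      using fin by (subst (asm) eq_commute, subst (asm) sum_nonneg_eq_0_iff) auto
    then show "x j = 0" using lin_injD[OF inj _ \<open>j \<in> J\<close>] by auto
  qed
  have "\<forall>j\<in>J. \<exists>y. \<forall>j'\<in>J. (\<Sum>l\<in>J. Q j' l * y l) = (if j = j' then 1 else 0)"
  proof
    fix j assume "j \<in> J"
    obtain y where "\<And>j'. j' \<in> J \<Longrightarrow> (\<Sum>l\<in>J. Q j' l * y l) = (if j = j' then 1 else 0)"
      using lin_inj_solution[OF fin(2) fin(2) refl injQ, of "\<lambda>j'. if j = j' then 1 else 0"] by blast
    then show "\<exists>y. \<forall>j'\<in>J. (\<Sum>l\<in>J. Q j' l * y l) = (if j = j' then 1 else 0)" by blast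
  qed
  from bchoice[OF this] obtain y
    where y: "\<forall>j\<in>J. \<forall>j'\<in>J. (\<Sum>l\<in>J. Q j' l * y j l) = (if j = j' then 1 else 0)" by blast
  show thesis
  proof (rule that[of "\<lambda>j i. \<Sum>l\<in>J. A i l * y j l"])
    fix j j' assume "j \<in> J" "j' \<in> J"
    have "(\<Sum>i\<in>I. (\<Sum>l\<in>J. A i l * y j l) * A i j') = (\<Sum>l\<in>J. Q j' l * y j l)"
      unfolding Q by (rule sum.cong[OF refl mult.commute])
    then show "(\<Sum>i\<in>I. (\<Sum>l\<in>J. A i l * y j l) * A i j') = (if j = j' then 1 else 0)"
      using y \<open>j \<in> J\<close> \<open>j' \<in> J\<close> by simp
  qed
qed

text \<open>A left inverse \<open>L\<close> bounds \<open>x\<close> by \<open>A x\<close>. If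
  \<open>A' x = 0\<close>, then \<open>A x = (A - A') x\<close> is small against the sum norm
  \<open>F\<close> of \<open>x\<close>, so that \<open>F \<le> F / 2\<close>.\<close>

lemma lin_inj_open:
  fixes A :: "'i \<Rightarrow> 'j \<Rightarrow> real"
  assumes fin: "finite I" "finite J" and inj: "lin_inj I J A"
  obtains e where "e > 0"
    "\<And>A'. (\<And>i j. i \<in> I \<Longrightarrow> j \<in> J \<Longrightarrow> \<bar>A' i j - A i j\<bar> < e) \<Longrightarrow> lin_inj I J A'"
proof -
  obtain L :: "'j \<Rightarrow> 'i \<Rightarrow> real"
    where L: "\<And>j j'. j \<in> J \<Longrightarrow> j' \<in> J \<Longrightarrow> (\<Sum>i\<in>I. L j i * A i j') = (if j = j' then 1 else 0)"
    using lin_inj_left_inverse[OF assms] by blast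
  define l where "l = 1 + (\<Sum>j\<in>J. \<Sum>i\<in>I. \<bar>L j i\<bar>)"
  have l: "l \<ge> 1" by (simp add: l_def sum_nonneg)
  define e where "e = 1 / (2 * l)"
  have e: "e > 0" using l by (simp add: e_def)
  show thesis
  proof (rule that[OF e], rule lin_injI)
    fix A' x j
    assume A': "\<And>i j. i \<in> I \<Longrightarrow> j \<in> J \<Longrightarrow> \<bar>A' i j - A i j\<bar> < e"
      and x: "\<And>i. i \<in> I \<Longrightarrow> (\<Sum>j\<in>J. A' i j * x j) = 0" and "j \<in> J"
    define F where "F = (\<Sum>j\<in>J. \<bar>x j\<bar>)"
    have F0: "F \<ge> 0" by (simp add: F_def sum_nonneg)
    have r: "\<bar>\<Sum>j\<in>J. A i j * x j\<bar> \<le> e * F" if i: "i \<in> I" for i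
    proof -
      have "(\<Sum>j\<in>J. A i j * x j) = (\<Sum>j\<in>J. (A i j - A' i j) * x j)"
        using x[OF i] by (simp add: algebra_simps sum_subtractf)
      also have "\<bar>\<dots>\<bar> \<le> (\<Sum>j\<in>J. \<bar>(A i j - A' i j) * x j\<bar>)" by (rule sum_abs)
      also have "\<dots> \<le> (\<Sum>j\<in>J. e * \<bar>x j\<bar>)"
        using A'[OF i] by (intro sum_mono) (force simp: abs_mult abs_minus_commute intro: mult_right_mono less_imp_le)
      finally show ?thesis by (simp add: F_def sum_distrib_left)
    qed
    have xj: "\<bar>x j\<bar> \<le> (\<Sum>i\<in>I. \<bar>L j i\<bar>) * (e * F)" if j: "j \<in> J" for j
    proof -
      have "x j = (\<Sum>j'\<in>J. (\<Sum>i\<in>I. L j i * A i j') * x j')"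
        using fin by (simp add: L[OF j] if_distrib[of "\<lambda>t. t * _"] sum.delta j cong: if_cong)
      also have "\<dots> = (\<Sum>i\<in>I. L j i * (\<Sum>j'\<in>J. A i j' * x j'))"
        unfolding sum_distrib_right sum_distrib_left by (subst sum.swap) (simp add: mult.assoc)
      also have "\<bar>\<dots>\<bar> \<le> (\<Sum>i\<in>I. \<bar>L j i * (\<Sum>j'\<in>J. A i j' * x j')\<bar>)" by (rule sum_abs)
      also have "\<dots> \<le> (\<Sum>i\<in>I. \<bar>L j i\<bar> * (e * F))"
        using r by (intro sum_mono) (auto simp: abs_mult intro: mult_left_mono)
      finally show ?thesis by (simp add: sum_distrib_right)
    qed
    have "F \<le> (\<Sum>j\<in>J. (\<Sum>i\<in>I. \<bar>L j i\<bar>) * (e * F))" unfolding F_def[symmetric]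
      by (subst F_def) (intro sum_mono xj)
    also have "\<dots> = (l - 1) * (e * F)" by (simp add: l_def sum_distrib_right)
    also have "\<dots> \<le> l * (e * F)" using e F0 by (intro mult_right_mono) auto
    also have "\<dots> = F / 2" using l by (simp add: e_def)
    finally have "F = 0" using F0 by simp
    then have "\<forall>j\<in>J. \<bar>x j\<bar> = 0"
      using fin(2) unfolding F_def by (subst (asm) sum_nonneg_eq_0_iff) auto
    then show "x j = 0" using \<open>j \<in> J\<close> by simp
  qed
qed

text \<open>The maps \<open>t\<close> and \<open>A\<close> form a sequence that is exact in the
  middle. That the kernel of \<open>A'\<close> still contains the image of \<open>t'\<close> is
  assumed; the point is that it contains nothing more. Stacking \<open>A\<close> on the transpose of
  \<open>t\<close> gives an injective matrix, and injectivity is an open condition.\<close>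

lemma exact_sequence_open:
  fixes A :: "'e \<Rightarrow> 'x \<Rightarrow> real" and t :: "'x \<Rightarrow> 'q \<Rightarrow> real"
  assumes fin: "finite E" "finite X" "finite Q"
    and exact: "\<And>f. (\<And>e. e \<in> E \<Longrightarrow> (\<Sum>x\<in>X. A e x * f x) = 0) \<Longrightarrow>
      \<exists>s. \<forall>x\<in>X. f x = (\<Sum>q\<in>Q. t x q * s q)"
    and inj: "lin_inj X Q t"
  obtains \<delta> where "\<delta> > 0"
    "\<And>A' t' f. (\<And>e x. e \<in> E \<Longrightarrow> x \<in> X \<Longrightarrow> \<bar>A' e x - A e x\<bar> < \<delta>) \<Longrightarrow>
       (\<And>x q. x \<in> X \<Longrightarrow> q \<in> Q \<Longrightarrow> \<bar>t' x q - t x q\<bar> < \<delta>) \<Longrightarrow>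
       (\<And>e q. e \<in> E \<Longrightarrow> q \<in> Q \<Longrightarrow> (\<Sum>x\<in>X. A' e x * t' x q) = 0) \<Longrightarrow>
       (\<And>e. e \<in> E \<Longrightarrow> (\<Sum>x\<in>X. A' e x * f x) = 0) \<Longrightarrow>
       \<exists>s. \<forall>x\<in>X. f x = (\<Sum>q\<in>Q. t' x q * s q)"
proof -
  define row where "row A e x = (case e of Inl e \<Rightarrow> A e x | Inr q \<Rightarrow> t x q)"
    for A :: "'e \<Rightarrow> 'x \<Rightarrow> real" and e x
  have injA: "lin_inj (E <+> Q) X (row A)"
  proof (rule lin_injI)
    fix f x assume f: "\<And>e. e \<in> E <+> Q \<Longrightarrow> (\<Sum>x\<in>X. row A e x * f x) = 0" and x: "x \<in> X"
    have "(\<Sum>x\<in>X. A e x * f x) = 0" if "e \<in> E" for e using f[OF InlI[OF that]] by (simp add: row_def)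
    from exact[OF this] obtain s where s: "\<forall>x\<in>X. f x = (\<Sum>q\<in>Q. t x q * s q)" by auto
    have "(\<Sum>x\<in>X. (f x)\<^sup>2) = (\<Sum>x\<in>X. \<Sum>q\<in>Q. s q * (t x q * f x))"
      using s by (intro sum.cong refl) (simp add: power2_eq_square sum_distrib_right mult_ac)
    also have "\<dots> = (\<Sum>q\<in>Q. s q * (\<Sum>x\<in>X. t x q * f x))"
      by (subst sum.swap) (simp add: sum_distrib_left)
    also have "\<dots> = 0"
      using f[OF InrI] by (intro sum.neutral) (simp add: row_def)
    finally have "\<forall>x\<in>X. (f x)\<^sup>2 = 0" using fin by (subst (asm) sum_nonneg_eq_0_iff) auto
    then show "f x = 0" using x by simp
  qed
  obtain e1 where e1: "e1 > 0"
    "\<And>R. (\<And>i j. i \<in> E <+> Q \<Longrightarrow> j \<in> X \<Longrightarrow> \<bar>R i j - row A i j\<bar> < e1) \<Longrightarrow> lin_inj (E <+> Q) X R"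
    using lin_inj_open[OF finite_Plus[OF fin(1,3)] fin(2) injA] by blast
  obtain e2 where e2: "e2 > 0"
    "\<And>R. (\<And>i j. i \<in> X \<Longrightarrow> j \<in> Q \<Longrightarrow> \<bar>R i j - t i j\<bar> < e2) \<Longrightarrow> lin_inj X Q R"
    using lin_inj_open[OF fin(2,3) inj] by blast
  show thesis
  proof (rule that[of "min e1 e2"])
    show "min e1 e2 > 0" using e1 e2 by simp
    fix A' t' f
    assume A': "\<And>e x. e \<in> E \<Longrightarrow> x \<in> X \<Longrightarrow> \<bar>A' e x - A e x\<bar> < min e1 e2"
      and t': "\<And>x q. x \<in> X \<Longrightarrow> q \<in> Q \<Longrightarrow> \<bar>t' x q - t x q\<bar> < min e1 e2"
      and zero: "\<And>e q. e \<in> E \<Longrightarrow> q \<in> Q \<Longrightarrow> (\<Sum>x\<in>X. A' e x * t' x q) = 0"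
      and f: "\<And>e. e \<in> E \<Longrightarrow> (\<Sum>x\<in>X. A' e x * f x) = 0"
    have R: "lin_inj (E <+> Q) X (row A')"
      using A' e1 by (intro e1(2)) (auto simp: row_def)
    have T: "lin_inj X Q t'" using t' by (intro e2(2)) auto
    have A't': "(\<Sum>x\<in>X. A' e x * (\<Sum>q\<in>Q. t' x q * s q)) = 0" if "e \<in> E" for e s
    proof -
      have "(\<Sum>x\<in>X. A' e x * (\<Sum>q\<in>Q. t' x q * s q)) = (\<Sum>q\<in>Q. s q * (\<Sum>x\<in>X. A' e x * t' x q))"
        unfolding sum_distrib_left by (subst sum.swap) (simp add: mult_ac)
      then show ?thesis using zero[OF that] by simp
    qed
    \<comment> \<open>A vector \<open>f\<close> in the kernel of \<open>A'\<close> is corrected by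
      some \<open>t' s\<close> so that the difference is orthogonal to the columns of the old
      \<open>t\<close>. The stacked matrix then annihilates the difference, which is therefore zero.
      \<open>N\<close> is the matrix of the equations for \<open>s\<close>.\<close>
    define N where "N q q' = (\<Sum>x\<in>X. t x q * t' x q')" for q q'
    have N: "(\<Sum>q'\<in>Q. N q q' * s q') = (\<Sum>x\<in>X. t x q * (\<Sum>q'\<in>Q. t' x q' * s q'))" for q s
      unfolding N_def sum_distrib_left sum_distrib_right by (subst sum.swap) (simp add: mult_ac)
    have "lin_inj Q Q N"
    proof (rule lin_injI)
      fix s q assume s: "\<And>q. q \<in> Q \<Longrightarrow> (\<Sum>q'\<in>Q. N q q' * s q') = 0" and q: "q \<in> Q"
      have "(\<Sum>q\<in>Q. t' x q * s q) = 0" if "x \<in> X" for x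
        by (rule lin_injD[OF R _ that]) (use A't' s N in \<open>auto simp: row_def\<close>)
      then show "s q = 0" using lin_injD[OF T _ q] by blast
    qed
    from lin_inj_solution[OF fin(3) fin(3) refl this, of "\<lambda>q. \<Sum>x\<in>X. t x q * f x"]
    obtain s where s: "\<And>q. q \<in> Q \<Longrightarrow> (\<Sum>q'\<in>Q. N q q' * s q') = (\<Sum>x\<in>X. t x q * f x)" by blast
    have "f x - (\<Sum>q\<in>Q. t' x q * s q) = 0" if "x \<in> X" for x
    proof (rule lin_injD[OF R _ that])
      fix e assume "e \<in> E <+> Q"
      then show "(\<Sum>x\<in>X. row A' e x * (f x - (\<Sum>q\<in>Q. t' x q * s q))) = 0"
        using f A't' s N by (auto simp: row_def right_diff_distrib sum_subtractf)
    qed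
    then show "\<exists>s. \<forall>x\<in>X. f x = (\<Sum>q\<in>Q. t' x q * s q)" by (intro exI[of _ s]) auto
  qed
qed

section \<open>Algebraically independent reals\<close>

lemma algebraically_independent_subset:
  "algebraically_independent_over_rat I a \<Longrightarrow> X \<subseteq> I \<Longrightarrow> algebraically_independent_over_rat X a"
  unfolding algebraically_independent_over_rat_def by blast

lemma eval_rat_poly_superset:
  assumes "finite I" "rat_poly_vars P \<subseteq> I"
  shows "eval_rat_poly a P = (\<Sum>m\<in>Poly_Mapping.keys P.
    real_of_rat (Poly_Mapping.lookup P m) * (\<Prod>x\<in>I. a x ^ Poly_Mapping.lookup m x))"
  unfolding eval_rat_poly_def
proof (intro sum.cong refl arg_cong2[where f = "(*)"] prod.mono_neutral_left)
  fix m assume "m \<in> Poly_Mapping.keys P"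
  then show "Poly_Mapping.keys m \<subseteq> I" using assms by (auto simp: rat_poly_vars_def)
qed (use assms in \<open>auto simp: in_keys_iff\<close>)

text \<open>Turns nested \<open>poly_mapping\<close>s into finite sums over exponent functions.
  Extensionality outside \<open>X\<close> makes distinct exponents give distinct monomials.\<close>

lemma algebraically_independentD:
  fixes c :: "('x \<Rightarrow> nat) \<Rightarrow> rat"
  assumes ind: "algebraically_independent_over_rat X a" and "finite X" "finite K"
    and K: "K \<subseteq> (\<Pi>\<^sub>E x\<in>X. UNIV)"
    and zero: "(\<Sum>m\<in>K. of_rat (c m) * (\<Prod>x\<in>X. a x ^ m x)) = 0" and "m \<in> K"
  shows "c m = 0"
proof -
  define emb :: "('x \<Rightarrow> nat) \<Rightarrow> ('x \<Rightarrow>\<^sub>0 nat)"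
    where "emb m = Abs_poly_mapping (\<lambda>x. if x \<in> X then m x else 0)" for m
  have emb: "Poly_Mapping.lookup (emb m) x = (if x \<in> X then m x else 0)" for m x
    unfolding emb_def using \<open>finite X\<close>
    by (subst lookup_Abs_poly_mapping) (auto intro: finite_subset[of _ X])
  have inj: "inj_on emb K"
  proof (rule inj_onI)
    fix m m' assume mm: "m \<in> K" "m' \<in> K" "emb m = emb m'"
    show "m = m'"
    proof
      fix x show "m x = m' x"
      proof (cases "x \<in> X")
        case True
        then show ?thesis using mm(3) emb[of m x] emb[of m' x] by simp
      next
        case False
        then show ?thesis using mm(1,2) K PiE_arb[of m X] PiE_arb[of m' X] by (metis subsetD)
      qed
    qed
  qed
  define P where "P = Abs_poly_mapping (\<lambda>l. if l \<in> emb ` K then c (inv_into K emb l) else 0)"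
  have P: "Poly_Mapping.lookup P l = (if l \<in> emb ` K then c (inv_into K emb l) else 0)" for l
    unfolding P_def using \<open>finite K\<close>
    by (subst lookup_Abs_poly_mapping) (auto intro: finite_subset[of _ "emb ` K"])
  have keys: "Poly_Mapping.keys P \<subseteq> emb ` K" by (auto simp: in_keys_iff P split: if_splits)
  have vars: "rat_poly_vars P \<subseteq> X"
    using keys by (fastforce simp: rat_poly_vars_def in_keys_iff emb split: if_splits)
  have "eval_rat_poly a P =
      (\<Sum>l\<in>emb ` K. real_of_rat (Poly_Mapping.lookup P l) * (\<Prod>x\<in>X. a x ^ Poly_Mapping.lookup l x))"
    unfolding eval_rat_poly_superset[OF \<open>finite X\<close> vars]
    using keys \<open>finite K\<close> by (intro sum.mono_neutral_left) (auto simp: in_keys_iff)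
  also have "\<dots> = (\<Sum>m\<in>K. of_rat (c m) * (\<Prod>x\<in>X. a x ^ m x))"
    using inj by (simp add: sum.reindex P emb)
  finally have "P = 0" using ind vars zero by (simp add: algebraically_independent_over_rat_def)
  then have "Poly_Mapping.lookup P (emb m) = 0" by simp
  then show ?thesis using inj \<open>m \<in> K\<close> by (simp add: P)
qed

section \<open>Existence of algebraically independent points\<close>

text \<open>A member \<open>(K, c)\<close> of \<open>F\<close> is a polynomial with exponent set
  \<open>K\<close> and coefficients \<open>c\<close>. One coordinate is added at a time: the earlier
  ones are chosen so that every polynomial stays nonzero in the new variable, and countably many
  roots do not fill an interval.\<close>

lemma nonvanishing_point_near:
  fixes F :: "(('x \<Rightarrow> nat) set \<times> (('x \<Rightarrow> nat) \<Rightarrow> real)) set"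
  assumes "finite I" "countable F" "\<eta> > 0"
    and "\<And>K c. (K, c) \<in> F \<Longrightarrow> finite K \<and> K \<noteq> {} \<and> (\<forall>m\<in>K. c m \<noteq> 0) \<and> inj_on (\<lambda>m. restrict m I) K"
  shows "\<exists>a. (\<forall>i\<in>I. \<bar>a i - b i\<bar> < \<eta>) \<and> (\<forall>(K, c)\<in>F. (\<Sum>m\<in>K. c m * (\<Prod>i\<in>I. a i ^ m i)) \<noteq> 0)"
  using assms(1,2,4)
proof (induction I arbitrary: F rule: finite_induct)
  case empty
  \<comment> \<open>Without variables all exponents agree, so each polynomial is a single nonzero
    constant.\<close>
  have "(\<Sum>m\<in>K. c m) \<noteq> 0" if Kc: "(K, c) \<in> F" for K c
  proof -
    have K: "finite K" "K \<noteq> {}" "\<forall>m\<in>K. c m \<noteq> 0" "inj_on (\<lambda>m. restrict m {}) K"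
      using empty.prems(2)[OF Kc] by blast+
    obtain m where "m \<in> K" using K by blast
    have "y = m" if "y \<in> K" for y
      by (rule inj_onD[OF K(4) _ that \<open>m \<in> K\<close>]) (simp add: restrict_def)
    then have "K = {m}" using \<open>m \<in> K\<close> by blast
    then show ?thesis using K by simp
  qed
  then show ?case by (intro exI[of _ undefined]) auto
next
  case (insert x I)
  \<comment> \<open>\<open>F'\<close> holds the coefficients, as polynomials in the variables
    \<open>I\<close>, of those powers of the variable \<open>x\<close> that occur.\<close>
  define F' where "F' = (\<lambda>((K, c), j). ({m \<in> K. m x = j}, c)) ` {((K, c), j). (K, c) \<in> F \<and> (\<exists>m\<in>K. m x = j)}"
  have "countable {((K, c), j::nat). (K, c) \<in> F \<and> (\<exists>m\<in>K. m x = j)}"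
    by (rule countable_subset[of _ "F \<times> UNIV"]) (auto intro!: countable_SIGMA insert.prems)
  then have "countable F'" unfolding F'_def by simp
  moreover have "finite K \<and> K \<noteq> {} \<and> (\<forall>m\<in>K. c m \<noteq> 0) \<and> inj_on (\<lambda>m. restrict m I) K"
    if K': "(K, c) \<in> F'" for K c
  proof -
    obtain K0 j where K0: "(K0, c) \<in> F" "K = {m \<in> K0. m x = j}" "\<exists>m\<in>K0. m x = j"
      using K' by (auto simp: F'_def)
    have "inj_on (\<lambda>m. restrict m I) K"
    proof (rule inj_onI)
      fix m m' assume mm: "m \<in> K" "m' \<in> K" "restrict m I = restrict m' I"
      then have "restrict m (insert x I) y = restrict m' (insert x I) y" for y
      proof (cases "y = x \<or> y \<notin> I")
        case True
        then show ?thesis using mm(1,2) K0(2) by (auto simp: restrict_def)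
      next
        case False
        then show ?thesis using mm(3) by (metis restrict_apply' insertCI)
      qed
      then have "restrict m (insert x I) = restrict m' (insert x I)" by blast
      moreover have "inj_on (\<lambda>m. restrict m (insert x I)) K0" using insert.prems(2)[OF K0(1)] by blast
      ultimately show "m = m'" using mm(1,2) K0(2) by (simp add: inj_on_def)
    qed
    then show ?thesis using insert.prems(2)[OF K0(1)] K0 by auto
  qed
  ultimately obtain a where a: "\<forall>i\<in>I. \<bar>a i - b i\<bar> < \<eta>"
    "\<forall>(K, c)\<in>F'. (\<Sum>m\<in>K. c m * (\<Prod>i\<in>I. a i ^ m i)) \<noteq> 0"
    using insert.IH[of F'] by blast
  define p where "p Kc = (\<Sum>m\<in>fst Kc. monom (snd Kc m * (\<Prod>i\<in>I. a i ^ m i)) (m x))" for Kc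
  have p: "poly (p (K, c)) t = (\<Sum>m\<in>K. c m * (t ^ m x * (\<Prod>i\<in>I. a i ^ m i)))" for K c t
    by (simp add: p_def poly_sum poly_monom mult_ac)
  have "p Kc \<noteq> 0" if Kc: "Kc \<in> F" for Kc
  proof -
    obtain K c where eq: "Kc = (K, c)" by force
    obtain m0 where m0: "m0 \<in> K" using insert.prems(2) Kc eq by fastforce
    have "coeff (p Kc) (m0 x) = (\<Sum>m\<in>K. if m x = m0 x then c m * (\<Prod>i\<in>I. a i ^ m i) else 0)"
      by (simp add: p_def eq coeff_sum coeff_monom)
    also have "\<dots> = (\<Sum>m\<in>{m\<in>K. m x = m0 x}. c m * (\<Prod>i\<in>I. a i ^ m i))"
      using insert.prems(2)[of K c] Kc eq by (intro sum.inter_filter[symmetric]) auto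
    also have "\<dots> \<noteq> 0"
    proof -
      have "({m\<in>K. m x = m0 x}, c) \<in> F'"
        unfolding F'_def using Kc eq m0 by (intro image_eqI[of _ _ "((K, c), m0 x)"]) auto
      then show ?thesis using a(2) by auto
    qed
    finally show ?thesis by auto
  qed
  then have "countable (\<Union>Kc\<in>F. {t. poly (p Kc) t = 0})"
    using insert.prems(1) by (intro countable_UN) (auto intro: countable_finite poly_roots_finite)
  moreover have "uncountable {b x - \<eta> <..< b x + \<eta>}"
    using \<open>\<eta> > 0\<close> by (simp add: uncountable_open_interval)
  ultimately have "{b x - \<eta> <..< b x + \<eta>} - (\<Union>Kc\<in>F. {t. poly (p Kc) t = 0}) \<noteq> {}"
    by (metis Diff_eq_empty_iff countable_subset)
  then obtain t where t: "t \<in> {b x - \<eta> <..< b x + \<eta>}" "\<And>Kc. Kc \<in> F \<Longrightarrow> poly (p Kc) t \<noteq> 0" by blast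
  have prod: "(\<Prod>i\<in>insert x I. (a(x := t)) i ^ m i) = t ^ m x * (\<Prod>i\<in>I. a i ^ m i)" for m
  proof -
    have "(\<Prod>i\<in>I. (a(x := t)) i ^ m i) = (\<Prod>i\<in>I. a i ^ m i)"
      using insert.hyps by (intro prod.cong) auto
    then show ?thesis using insert.hyps by simp
  qed
  have "\<forall>(K, c)\<in>F. (\<Sum>m\<in>K. c m * (\<Prod>i\<in>insert x I. (a(x := t)) i ^ m i)) \<noteq> 0"
    unfolding prod p[symmetric] using t(2) by auto
  moreover have "\<forall>i\<in>insert x I. \<bar>(a(x := t)) i - b i\<bar> < \<eta>" using a(1) t(1) by auto
  ultimately show ?case by blast
qed

text \<open>The type of variables may be uncountable, so polynomials are encoded by exponent lists
  along an enumeration \<open>xs\<close> of \<open>I\<close>.\<close>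

lemma countable_rat_polys:
  assumes "finite I"
  shows "countable {P. rat_poly_vars P \<subseteq> I}"
proof -
  obtain xs where xs: "set xs = I" using finite_list[OF assms] by blast
  define enc where "enc P = (\<lambda>m. (map (Poly_Mapping.lookup m) xs, Poly_Mapping.lookup P m)) ` Poly_Mapping.keys P"
    for P :: "('a \<Rightarrow>\<^sub>0 nat) \<Rightarrow>\<^sub>0 rat"
  have monom_eq: "m = m'" if "Poly_Mapping.keys m \<subseteq> I" "Poly_Mapping.keys m' \<subseteq> I"
    "map (Poly_Mapping.lookup m) xs = map (Poly_Mapping.lookup m') xs" for m m' :: "'a \<Rightarrow>\<^sub>0 nat"
  proof (rule poly_mapping_eqI)
    fix x show "Poly_Mapping.lookup m x = Poly_Mapping.lookup m' x"
    proof (cases "x \<in> I")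
      case False
      then have "x \<notin> Poly_Mapping.keys m" "x \<notin> Poly_Mapping.keys m'" using that by auto
      then show ?thesis by (simp add: in_keys_iff)
    qed (use that xs in auto)
  qed
  have lookup_eq: "Poly_Mapping.lookup P m = Poly_Mapping.lookup Q m"
    if "rat_poly_vars P \<subseteq> I" "rat_poly_vars Q \<subseteq> I" "enc P \<subseteq> enc Q" "m \<in> Poly_Mapping.keys P" for P Q m
  proof -
    have "(map (Poly_Mapping.lookup m) xs, Poly_Mapping.lookup P m) \<in> enc Q"
      using that(3,4) by (auto simp: enc_def)
    then obtain m' where m': "m' \<in> Poly_Mapping.keys Q" "map (Poly_Mapping.lookup m) xs = map (Poly_Mapping.lookup m') xs"
      "Poly_Mapping.lookup P m = Poly_Mapping.lookup Q m'" by (auto simp: enc_def)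
    have "m = m'" using that m' by (intro monom_eq) (auto simp: rat_poly_vars_def)
    then show ?thesis using m' by simp
  qed
  have "inj_on enc {P. rat_poly_vars P \<subseteq> I}"
  proof (rule inj_onI)
    fix P Q assume PQ: "P \<in> {P. rat_poly_vars P \<subseteq> I}" "Q \<in> {P. rat_poly_vars P \<subseteq> I}" "enc P = enc Q"
    have "Poly_Mapping.lookup P m = Poly_Mapping.lookup Q m" for m
    proof (cases "m \<in> Poly_Mapping.keys P \<or> m \<in> Poly_Mapping.keys Q")
      case True
      then show ?thesis using lookup_eq[of P Q m] lookup_eq[of Q P m] PQ by auto
    next
      case False
      then show ?thesis by (simp add: in_keys_iff)
    qed
    then show "P = Q" by (rule poly_mapping_eqI)
  qed
  moreover have "countable (enc ` {P. rat_poly_vars P \<subseteq> I})"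
    by (rule countable_subset[OF _ countable_Collect_finite]) (auto simp: enc_def)
  ultimately show ?thesis by (metis countable_image_inj_on)
qed

lemma algebraically_independent_near:
  assumes "finite I" "\<eta> > 0"
  obtains a where "algebraically_independent_over_rat I a" "\<And>i. i \<in> I \<Longrightarrow> \<bar>a i - b i\<bar> < \<eta>"
proof -
  define F where "F = (\<lambda>P. (Poly_Mapping.lookup ` Poly_Mapping.keys P,
      \<lambda>m. real_of_rat (Poly_Mapping.lookup P (Abs_poly_mapping m)))) ` {P. rat_poly_vars P \<subseteq> I \<and> P \<noteq> 0}"
  have "countable {P. rat_poly_vars P \<subseteq> I \<and> P \<noteq> 0}"
    by (rule countable_subset[OF _ countable_rat_polys[OF assms(1)]]) auto
  then have "countable F" unfolding F_def by simp
  moreover have "finite K \<and> K \<noteq> {} \<and> (\<forall>m\<in>K. c m \<noteq> 0) \<and> inj_on (\<lambda>m. restrict m I) K"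
    if Kc: "(K, c) \<in> F" for K c
  proof -
    obtain P where P: "rat_poly_vars P \<subseteq> I" "P \<noteq> 0" "K = Poly_Mapping.lookup ` Poly_Mapping.keys P"
      "c = (\<lambda>m. real_of_rat (Poly_Mapping.lookup P (Abs_poly_mapping m)))"
      using Kc unfolding F_def by blast
    have "inj_on (\<lambda>m. restrict m I) K"
    proof (rule inj_onI)
      fix m m' assume mm: "m \<in> K" "m' \<in> K" "restrict m I = restrict m' I"
      have out: "l x = 0" if "l \<in> K" "x \<notin> I" for l x
        using that P by (force simp: rat_poly_vars_def in_keys_iff)
      show "m = m'"
      proof
        fix x show "m x = m' x"
          using mm out[OF mm(1), of x] out[OF mm(2), of x] by (metis restrict_apply')
      qed
    qed
    then show ?thesis using P by (auto simp: in_keys_iff lookup_inverse)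
  qed
  ultimately obtain a where a: "\<forall>i\<in>I. \<bar>a i - b i\<bar> < \<eta>"
    "\<forall>(K, c)\<in>F. (\<Sum>m\<in>K. c m * (\<Prod>i\<in>I. a i ^ m i)) \<noteq> 0"
    using nonvanishing_point_near[OF assms(1) _ assms(2), of F b] by blast
  have "P = 0" if P: "rat_poly_vars P \<subseteq> I" "eval_rat_poly a P = 0" for P
  proof (rule ccontr)
    assume "P \<noteq> 0"
    then have "(Poly_Mapping.lookup ` Poly_Mapping.keys P,
      \<lambda>m. real_of_rat (Poly_Mapping.lookup P (Abs_poly_mapping m))) \<in> F" using P by (auto simp: F_def)
    from bspec[OF a(2) this] have "eval_rat_poly a P \<noteq> 0"
      by (simp add: eval_rat_poly_superset[OF assms(1) P(1)] sum.reindex inj_on_def lookup_inject lookup_inverse)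
    then show False using P by simp
  qed
  then have "algebraically_independent_over_rat I a" by (auto simp: algebraically_independent_over_rat_def)
  then show thesis using a(1) that by blast
qed

section \<open>Transcendence degree by counting dimensions over the rationals\<close>

interpretation rat_real: vector_space "\<lambda>q r. real_of_rat q * r"
  by unfold_locales (simp_all add: algebra_simps of_rat_add of_rat_mult)

definition bounded_monomials :: "real set \<Rightarrow> nat \<Rightarrow> real set" where
  "bounded_monomials T c = (\<lambda>e. \<Prod>t\<in>T. t ^ e t) ` (\<Pi>\<^sub>E t\<in>T. {..c})"

text \<open>Values at \<open>T\<close> of rational polynomials with degree at most \<open>c\<close>
  in each variable. Bounding the degrees separately makes the dimension bound a plain power
  \<open>(c + 1) ^ card T\<close>.\<close>

definition bounded_rat_polys :: "real set \<Rightarrow> nat \<Rightarrow> real set" where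
  "bounded_rat_polys T c = rat_real.span (bounded_monomials T c)"

lemma card_bounded_monomials:
  assumes "finite T"
  shows "finite (bounded_monomials T c)" "card (bounded_monomials T c) \<le> (c + 1) ^ card T"
proof -
  have fin: "finite (\<Pi>\<^sub>E t\<in>T. {..c})" using assms by (intro finite_PiE) auto
  then show "finite (bounded_monomials T c)" by (simp add: bounded_monomials_def)
  have "card (bounded_monomials T c) \<le> card (\<Pi>\<^sub>E t\<in>T. {..c})"
    unfolding bounded_monomials_def by (rule card_image_le[OF fin])
  then show "card (bounded_monomials T c) \<le> (c + 1) ^ card T" using assms by (simp add: card_PiE)
qed

lemma bounded_monomialsI:
  assumes "\<And>t. t \<in> T \<Longrightarrow> e t \<le> c" shows "(\<Prod>t\<in>T. t ^ e t) \<in> bounded_monomials T c"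
  unfolding bounded_monomials_def
  by (rule image_eqI[of _ _ "restrict e T"]) (auto simp: assms intro!: prod.cong)

lemma bounded_rat_polys_mono: "c \<le> c' \<Longrightarrow> bounded_rat_polys T c \<subseteq> bounded_rat_polys T c'"
  unfolding bounded_rat_polys_def bounded_monomials_def
  by (intro rat_real.span_mono image_mono PiE_mono) auto

lemma bounded_rat_polys_rat: "real_of_rat q \<in> bounded_rat_polys T c"
proof -
  have "(1::real) \<in> bounded_monomials T c" using bounded_monomialsI[of T "\<lambda>_. 0" c] by simp
  then show ?thesis
    unfolding bounded_rat_polys_def using rat_real.span_scale[OF rat_real.span_base, of 1 _ q] by simp
qed

lemma bounded_rat_polys_gen:
  assumes "finite T" "t \<in> T" shows "t \<in> bounded_rat_polys T 1"
proof -
  have "(\<Prod>u\<in>T. u ^ (if u = t then 1 else 0)) = (\<Prod>u\<in>T. if u = t then u else 1)"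
    by (intro prod.cong) auto
  also have "\<dots> = t" using assms by (simp add: prod.delta)
  finally have "t \<in> bounded_monomials T 1"
    using bounded_monomialsI[of T "\<lambda>u. if u = t then 1 else 0" 1] by (auto split: if_splits)
  then show ?thesis unfolding bounded_rat_polys_def by (rule rat_real.span_base)
qed

lemma bounded_rat_polys_add:
  "x \<in> bounded_rat_polys T c \<Longrightarrow> y \<in> bounded_rat_polys T c \<Longrightarrow> x + y \<in> bounded_rat_polys T c"
  unfolding bounded_rat_polys_def by (rule rat_real.span_add)

lemma bounded_rat_polys_mult:
  assumes x: "x \<in> bounded_rat_polys T c" and y: "y \<in> bounded_rat_polys T c'"
  shows "x * y \<in> bounded_rat_polys T (c + c')"
proof -
  have base: "u * v \<in> bounded_rat_polys T (c + c')"
    if u: "u \<in> bounded_monomials T c" and v: "v \<in> bounded_monomials T c'" for u v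
  proof -
    obtain e e' where e: "u = (\<Prod>t\<in>T. t ^ e t)" "\<And>t. t \<in> T \<Longrightarrow> e t \<le> c"
      and e': "v = (\<Prod>t\<in>T. t ^ e' t)" "\<And>t. t \<in> T \<Longrightarrow> e' t \<le> c'"
      using u v by (auto simp: bounded_monomials_def PiE_def Pi_def)
    have "u * v = (\<Prod>t\<in>T. t ^ (e t + e' t))" by (simp add: e e' power_add prod.distrib)
    also have "\<dots> \<in> bounded_monomials T (c + c')" using e e' by (intro bounded_monomialsI add_mono)
    finally show ?thesis unfolding bounded_rat_polys_def by (rule rat_real.span_base)
  qed
  have step: "u * y \<in> bounded_rat_polys T (c + c')" if u: "u \<in> bounded_monomials T c" for u
    using y unfolding bounded_rat_polys_def
  proof (induction rule: rat_real.span_induct_alt)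
    case base
    then show ?case by (simp add: rat_real.span_zero)
  next
    case (step q v w)
    have "u * (real_of_rat q * v + w) = real_of_rat q * (u * v) + u * w" by (simp add: algebra_simps)
    then show ?case
      using base[OF u step(1)] step(2)
      by (auto simp: bounded_rat_polys_def intro!: rat_real.span_add rat_real.span_scale)
  qed
  show ?thesis
    using x unfolding bounded_rat_polys_def
  proof (induction rule: rat_real.span_induct_alt)
    case base
    then show ?case by (simp add: rat_real.span_zero)
  next
    case (step q v w)
    have "(real_of_rat q * v + w) * y = real_of_rat q * (v * y) + w * y" by (simp add: algebra_simps)
    then show ?case
      using \<open>\<And>u. u \<in> bounded_monomials T c \<Longrightarrow> u * y \<in> bounded_rat_polys T (c + c')\<close>[OF step(1)] step(2)
      by (auto simp: bounded_rat_polys_def intro!: rat_real.span_add rat_real.span_scale)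
  qed
qed

lemma bounded_rat_polys_power:
  "x \<in> bounded_rat_polys T c \<Longrightarrow> x ^ N \<in> bounded_rat_polys T (N * c)"
proof (induction N)
  case 0
  then show ?case using bounded_rat_polys_rat[of 1 T 0] by simp
next
  case (Suc N)
  then show ?case using bounded_rat_polys_mult[of x T c "x ^ N" "N * c"] by simp
qed

lemma bounded_rat_polys_prod:
  assumes "finite A" "\<And>i. i \<in> A \<Longrightarrow> f i \<in> bounded_rat_polys T (c i)"
  shows "(\<Prod>i\<in>A. f i) \<in> bounded_rat_polys T (\<Sum>i\<in>A. c i)"
  using assms
proof (induction A rule: finite_induct)
  case empty
  then show ?case using bounded_rat_polys_rat[of 1 T 0] by simp
next
  case (insert i A)
  then show ?case using bounded_rat_polys_mult[of "f i" T "c i" "prod f A" "sum c A"] by simp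
qed

text \<open>The field generated by \<open>T\<close>. As \<open>inverse 0 = 0\<close>, inversion
  carries no side condition.\<close>

inductive_set rat_field :: "real set \<Rightarrow> real set" for T :: "real set" where
  gen: "t \<in> T \<Longrightarrow> t \<in> rat_field T"
| rat: "real_of_rat q \<in> rat_field T"
| add: "x \<in> rat_field T \<Longrightarrow> y \<in> rat_field T \<Longrightarrow> x + y \<in> rat_field T"
| mult: "x \<in> rat_field T \<Longrightarrow> y \<in> rat_field T \<Longrightarrow> x * y \<in> rat_field T"
| inv: "x \<in> rat_field T \<Longrightarrow> inverse x \<in> rat_field T"

lemma real_subfield_rat_field: "real_subfield (rat_field T)"
proof -
  have "- x \<in> rat_field T" if "x \<in> rat_field T" for x
    using rat_field.mult[OF rat_field.rat[of "-1"] that] by simp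
  moreover have "0 \<in> rat_field T" "1 \<in> rat_field T"
    using rat_field.rat[of 0 T] rat_field.rat[of 1 T] by auto
  ultimately show ?thesis by (auto simp: real_subfield_def intro: rat_field.intros)
qed

lemma rat_field_fraction:
  assumes "finite T" "r \<in> rat_field T"
  shows "\<exists>c n D. n \<in> bounded_rat_polys T c \<and> D \<in> bounded_rat_polys T c \<and> D \<noteq> 0 \<and> r = n / D"
  using assms(2)
proof (induction rule: rat_field.induct)
  case (gen t)
  then show ?case
    using bounded_rat_polys_gen[OF assms(1)] bounded_rat_polys_rat[of 1 T 1]
    by (intro exI[of _ 1] exI[of _ t]) auto
next
  case (rat q)
  then show ?case
    using bounded_rat_polys_rat[of q T 0] bounded_rat_polys_rat[of 1 T 0]
    by (intro exI[of _ 0] exI[of _ "of_rat q"] exI[of _ 1]) auto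
next
  case (add x y)
  then obtain c n D c' n' D' where x: "n \<in> bounded_rat_polys T c" "D \<in> bounded_rat_polys T c" "D \<noteq> 0" "x = n / D"
    and y: "n' \<in> bounded_rat_polys T c'" "D' \<in> bounded_rat_polys T c'" "D' \<noteq> 0" "y = n' / D'" by metis
  have "n * D' + D * n' \<in> bounded_rat_polys T (c + c')" "D * D' \<in> bounded_rat_polys T (c + c')"
    using x y by (auto intro!: bounded_rat_polys_add bounded_rat_polys_mult)
  then show ?case using x y
    by (intro exI[of _ "c + c'"] exI[of _ "n * D' + D * n'"] exI[of _ "D * D'"]) (auto simp: field_simps)
next
  case (mult x y)
  then obtain c n D c' n' D' where x: "n \<in> bounded_rat_polys T c" "D \<in> bounded_rat_polys T c" "D \<noteq> 0" "x = n / D"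
    and y: "n' \<in> bounded_rat_polys T c'" "D' \<in> bounded_rat_polys T c'" "D' \<noteq> 0" "y = n' / D'" by metis
  have "n * n' \<in> bounded_rat_polys T (c + c')" "D * D' \<in> bounded_rat_polys T (c + c')"
    using x y by (auto intro!: bounded_rat_polys_mult)
  then show ?case using x y
    by (intro exI[of _ "c + c'"] exI[of _ "n * n'"] exI[of _ "D * D'"]) auto
next
  case (inv x)
  then obtain c n D where x: "n \<in> bounded_rat_polys T c" "D \<in> bounded_rat_polys T c" "D \<noteq> 0" "x = n / D"
    by metis
  show ?case
  proof (cases "n = 0")
    case True
    then show ?thesis using x by auto
  next
    case False
    then show ?thesis using x by (intro exI[of _ c] exI[of _ D] exI[of _ n]) auto
  qed
qed

lemma common_denominator:
  assumes "finite T" "finite X" "\<And>x. x \<in> X \<Longrightarrow> a x \<in> rat_field T"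
  shows "\<exists>c n D. (\<forall>x\<in>X. n x \<in> bounded_rat_polys T c \<and> a x = n x / D) \<and> D \<in> bounded_rat_polys T c \<and> D \<noteq> 0"
  using assms(2,3)
proof (induction X rule: finite_induct)
  case empty
  then show ?case using bounded_rat_polys_rat[of 1 T 0]
    by (intro exI[of _ 0] exI[of _ "\<lambda>_. 0"] exI[of _ 1]) auto
next
  case (insert y X)
  then obtain c n D where X: "\<forall>x\<in>X. n x \<in> bounded_rat_polys T c \<and> a x = n x / D"
    "D \<in> bounded_rat_polys T c" "D \<noteq> 0" by auto
  obtain c' n' D' where y: "n' \<in> bounded_rat_polys T c'" "D' \<in> bounded_rat_polys T c'" "D' \<noteq> 0" "a y = n' / D'"
    using rat_field_fraction[OF assms(1), of "a y"] insert.prems by auto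
  have "\<forall>x\<in>X. n x * D' \<in> bounded_rat_polys T (c + c')" "D * n' \<in> bounded_rat_polys T (c + c')"
    "D * D' \<in> bounded_rat_polys T (c + c')"
    using X y by (auto intro: bounded_rat_polys_mult)
  then show ?case using X y insert.hyps
    by (intro exI[of _ "c + c'"] exI[of _ "\<lambda>x. if x = y then D * n' else n x * D'"] exI[of _ "D * D'"]) auto
qed

text \<open>The \<open>(N + 1) ^ card X\<close> monomials in the numbers \<open>a x\<close> with
  exponents up to \<open>N\<close>, cleared of denominators, are independent over the rationals. Yet
  they lie in a space whose dimension grows only like \<open>N ^ card T\<close>.\<close>

lemma algebraically_independent_card_le:
  assumes ind: "algebraically_independent_over_rat X a" and fin: "finite X" "finite T"
    and rat: "\<And>x. x \<in> X \<Longrightarrow> a x \<in> rat_field T"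
  shows "card X \<le> card T"
proof (rule ccontr)
  assume less: "\<not> card X \<le> card T"
  obtain c n D where n: "\<And>x. x \<in> X \<Longrightarrow> n x \<in> bounded_rat_polys T c" and D: "D \<in> bounded_rat_polys T c" "D \<noteq> 0"
    and a: "\<And>x. x \<in> X \<Longrightarrow> a x = n x / D"
    using common_denominator[of T X a, OF fin(2,1)] rat by fastforce
  define b where "b = card X"
  have b: "b \<ge> 1" using less by (simp add: b_def)
  define M where "M = (c + 1) * b"
  have M: "M \<ge> 1" using b by (simp add: M_def)
  \<comment> \<open>Chosen so that \<open>(M * (N + 1)) ^ (b - 1) = N * (N + 1) ^ (b - 1)\<close>,
    just below \<open>(N + 1) ^ b\<close>. The factor \<open>c + 1\<close> in \<open>M\<close>,
    rather than \<open>c\<close>, keeps \<open>M\<close> positive when \<open>c = 0\<close>.\<close>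
  define N where "N = M ^ (b - 1)"
  define K where "K = (\<Pi>\<^sub>E x\<in>X. {..N})"
  have finK: "finite K" unfolding K_def using fin by (intro finite_PiE) auto
  have cardK: "card K = (N + 1) ^ b" using fin by (simp add: K_def b_def card_PiE)
  define v where "v m = D ^ (b * N) * (\<Prod>x\<in>X. a x ^ m x)" for m
  have v_mem: "v m \<in> bounded_rat_polys T (M * N)" if m: "m \<in> K" for m
  proof -
    have mN: "m x \<le> N" if "x \<in> X" for x using m that by (auto simp: K_def)
    have "v m = (\<Prod>x\<in>X. D ^ N * a x ^ m x)" using fin by (simp add: v_def prod.distrib b_def power_mult mult.commute)
    also have "\<dots> = (\<Prod>x\<in>X. D ^ (N - m x) * n x ^ m x)"
    proof (intro prod.cong refl)
      fix x assume x: "x \<in> X"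
      have "D ^ N = D ^ (N - m x) * D ^ m x" using mN[OF x] by (simp flip: power_add)
      then show "D ^ N * a x ^ m x = D ^ (N - m x) * n x ^ m x"
        using D by (simp add: a[OF x] power_divide)
    qed
    also have "\<dots> \<in> bounded_rat_polys T (\<Sum>x\<in>X. (N - m x) * c + m x * c)"
      using n D fin by (intro bounded_rat_polys_prod bounded_rat_polys_mult bounded_rat_polys_power) auto
    also have "(\<Sum>x\<in>X. (N - m x) * c + m x * c) = (\<Sum>x\<in>X. N * c)"
      using mN by (intro sum.cong refl) (simp flip: distrib_right)
    finally have "v m \<in> bounded_rat_polys T (\<Sum>x\<in>X. N * c)" .
    moreover have "(\<Sum>x\<in>X. N * c) \<le> M * N" by (simp add: b_def M_def)
    ultimately show ?thesis using bounded_rat_polys_mono by blast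
  qed
  have zero: "q m = 0" if "(\<Sum>m\<in>K. real_of_rat (q m) * v m) = 0" "m \<in> K" for q m
  proof -
    have "(\<Sum>m\<in>K. real_of_rat (q m) * v m) = D ^ (b * N) * (\<Sum>m\<in>K. real_of_rat (q m) * (\<Prod>x\<in>X. a x ^ m x))"
      by (simp add: v_def sum_distrib_left mult_ac)
    then have "(\<Sum>m\<in>K. real_of_rat (q m) * (\<Prod>x\<in>X. a x ^ m x)) = 0" using that D by simp
    then show ?thesis
      using algebraically_independentD[OF ind fin(1) finK _ _ \<open>m \<in> K\<close>] by (auto simp: K_def)
  qed
  have inj: "inj_on v K"
  proof (rule inj_onI, rule ccontr)
    fix m m' assume m: "m \<in> K" "m' \<in> K" "v m = v m'" "m \<noteq> m'"
    define q :: "('a \<Rightarrow> nat) \<Rightarrow> rat" where "q l = (if l = m then 1 else 0) - (if l = m' then 1 else 0)" for l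
    have "(\<Sum>l\<in>K. real_of_rat (q l) * v l) = (\<Sum>l\<in>K. (if l = m then v l else 0) - (if l = m' then v l else 0))"
      using m by (intro sum.cong) (auto simp: q_def)
    also have "\<dots> = 0" using m finK by (simp add: sum_subtractf)
    finally have "q m = 0" using zero m by blast
    then show False using m by (simp add: q_def)
  qed
  have "rat_real.independent (v ` K)"
  proof
    assume "rat_real.dependent (v ` K)"
    then obtain u where u: "\<exists>w\<in>v ` K. u w \<noteq> 0" "(\<Sum>w\<in>v ` K. real_of_rat (u w) * w) = 0"
      using rat_real.dependent_finite[of "v ` K"] finK by auto
    then show False using zero[of "\<lambda>m. u (v m)"] inj by (auto simp: sum.reindex)
  qed
  moreover have "v ` K \<subseteq> rat_real.span (bounded_monomials T (M * N))"
    using v_mem by (auto simp: bounded_rat_polys_def)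
  ultimately have "card (v ` K) \<le> card (bounded_monomials T (M * N))"
    using rat_real.independent_span_bound card_bounded_monomials(1)[OF fin(2)] by blast
  also have "\<dots> \<le> (M * N + 1) ^ card T" by (rule card_bounded_monomials(2)[OF fin(2)])
  also have "\<dots> \<le> (M * N + 1) ^ (b - 1)" using less by (intro power_increasing) (auto simp: b_def)
  also have "\<dots> \<le> (M * (N + 1)) ^ (b - 1)" using M by (intro power_mono) auto
  also have "\<dots> = N * (N + 1) ^ (b - 1)" by (simp only: N_def power_mult_distrib)
  also have "\<dots> < (N + 1) * (N + 1) ^ (b - 1)" by simp
  also have "\<dots> = (N + 1) ^ b" using b by (cases b) auto
  finally show False using inj cardK by (simp add: card_image)
qed

section \<open>Generic matrices and sparse symmetric products\<close>

lemma sum_swap_left: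
  fixes a :: "'j \<Rightarrow> real"
  shows "(\<Sum>v\<in>C. \<Sum>j\<in>J. a j * h v j) = (\<Sum>j\<in>J. a j * (\<Sum>v\<in>C. h v j))"
  by (subst sum.swap) (simp add: sum_distrib_left)

lemma ex_maximal_subset:
  assumes "finite C" "Q {}"
  shows "\<exists>I\<subseteq>C. Q I \<and> (\<forall>i\<in>C - I. \<not> Q (insert i I))"
proof -
  have "finite {I. I \<subseteq> C \<and> Q I}" "{I. I \<subseteq> C \<and> Q I} \<noteq> {}" using assms by auto
  then obtain I where I: "I \<subseteq> C \<and> Q I" "\<And>I'. I' \<subseteq> C \<and> Q I' \<Longrightarrow> I \<subseteq> I' \<Longrightarrow> I = I'"
    using finite_has_maximal[of "{I. I \<subseteq> C \<and> Q I}"] by auto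
  have "\<not> Q (insert i I)" if "i \<in> C - I" for i using that I(1) I(2)[of "insert i I"] by blast
  then show ?thesis using I(1) by blast
qed

lemma lin_inj_empty [simp]: "lin_inj I {} A"
  by (simp add: lin_inj_def)

lemma lin_inj_insert_dependent:
  assumes "finite J" "lin_inj I J A" "\<not> lin_inj I (insert j J) A"
  shows "\<exists>c. \<forall>i\<in>I. A i j = (\<Sum>l\<in>J. A i l * c l)"
proof -
  have j: "j \<notin> J" using assms by (auto simp: insert_absorb)
  obtain x l where x: "\<And>i. i \<in> I \<Longrightarrow> (\<Sum>l\<in>insert j J. A i l * x l) = 0" and l: "l \<in> insert j J" "x l \<noteq> 0"
    using assms(3) unfolding lin_inj_def by blast
  have eq: "A i j * x j + (\<Sum>l\<in>J. A i l * x l) = 0" if "i \<in> I" for i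
    using x[OF that] assms(1) j by simp
  have xj: "x j \<noteq> 0"
  proof
    assume "x j = 0"
    then have "l \<in> J" using l by auto
    then show False using lin_injD[OF assms(2), of x l] eq \<open>x j = 0\<close> l by auto
  qed
  show ?thesis
  proof (intro exI[of _ "\<lambda>l. - x l / x j"] ballI)
    fix i assume "i \<in> I"
    have "(\<Sum>l\<in>J. A i l * (- x l / x j)) = - (\<Sum>l\<in>J. A i l * x l) / x j"
      by (simp add: sum_negf sum_divide_distrib)
    also have "\<dots> = A i j" using eq[OF \<open>i \<in> I\<close>] xj by (simp add: field_simps)
    finally show "A i j = (\<Sum>l\<in>J. A i l * (- x l / x j))" by simp
  qed
qed

text \<open>Row rank equals column rank: for a maximal independent set \<open>S\<close> of columns,
  a relation among the rows on \<open>S\<close> extends to all columns.\<close>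

lemma lin_inj_square_submatrix:
  assumes fin: "finite I" "finite J" and inj: "lin_inj J I (\<lambda>j i. x i j)"
  obtains S where "S \<subseteq> J" "card S = card I" "lin_inj I S x"
proof -
  obtain S where S: "S \<subseteq> J" "lin_inj I S x" "\<forall>j\<in>J - S. \<not> lin_inj I (insert j S) x"
    using ex_maximal_subset[where Q = "\<lambda>S. lin_inj I S x", OF fin(2)] by auto
  have finS: "finite S" using S(1) fin(2) by (rule finite_subset)
  have "lin_inj S I (\<lambda>j i. x i j)"
  proof (rule lin_injI)
    fix c i assume c: "\<And>j. j \<in> S \<Longrightarrow> (\<Sum>i\<in>I. x i j * c i) = 0" and "i \<in> I"
    have "(\<Sum>i\<in>I. x i j * c i) = 0" if j: "j \<in> J" for j
    proof (cases "j \<in> S")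
      case False
      obtain g where g: "\<And>i. i \<in> I \<Longrightarrow> x i j = (\<Sum>l\<in>S. x i l * g l)"
        using lin_inj_insert_dependent[OF finS S(2)] S(3) j False by blast
      have "(\<Sum>i\<in>I. x i j * c i) = (\<Sum>i\<in>I. \<Sum>l\<in>S. g l * (x i l * c i))"
        by (intro sum.cong refl) (simp add: g sum_distrib_left sum_distrib_right mult_ac)
      also have "\<dots> = (\<Sum>l\<in>S. g l * (\<Sum>i\<in>I. x i l * c i))"
        by (subst sum.swap) (simp add: sum_distrib_left)
      finally show ?thesis using c by simp
    qed (use c in auto)
    then show "c i = 0" using lin_injD[OF inj _ \<open>i \<in> I\<close>] by auto
  qed
  then have "card I \<le> card S" using lin_inj_card_le fin finS by blast
  moreover have "card S \<le> card I" using lin_inj_card_le[OF S(2)] fin finS by blast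
  ultimately show thesis using that S by simp
qed

text \<open>
  The column space of \<open>M\<close> meets that of \<open>P\<close> in at least half its dimension, since the
  orthogonal complement of the latter is totally isotropic for \<open>M\<close>. The vectors \<open>x i\<close> for
  \<open>i \<in> I2\<close> parametrise this intersection.
\<close>

lemma symmetric_product_intersection:
  fixes M :: "'c \<Rightarrow> 'c \<Rightarrow> real" and P B :: "'c \<Rightarrow> 'j \<Rightarrow> real"
  assumes fin: "finite C" "finite J"
    and M: "\<And>u v. u \<in> C \<Longrightarrow> v \<in> C \<Longrightarrow> M u v = (\<Sum>j\<in>J. P u j * B v j + B u j * P v j)"
    and P: "lin_inj C J P" and nz: "u0 \<in> C" "v0 \<in> C" "M u0 v0 \<noteq> 0"
  obtains I1 I2 x b where "I1 \<subseteq> C" "I2 \<subseteq> C" "I2 \<noteq> {}" "card I1 \<le> card I2"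
    "\<And>i u. i \<in> I2 \<Longrightarrow> u \<in> C \<Longrightarrow> (\<Sum>j\<in>J. P u j * x i j) = M u i - (\<Sum>l\<in>I1. M u l * b i l)"
    "lin_inj J I2 (\<lambda>j i. x i j)"
proof -
  define R where "R u k = (case k of Inl j \<Rightarrow> P u j | Inr i \<Rightarrow> M u i)" for u k
  have sumR: "(\<Sum>k\<in>J <+> A. R u k * z k) = (\<Sum>j\<in>J. P u j * z (Inl j)) + (\<Sum>i\<in>A. M u i * z (Inr i))"
    if "finite A" for A u z
    using fin that by (simp add: sum.Plus R_def comp_def)
  \<comment> \<open>\<open>I\<close> indexes a basis of the column space of
    \<open>M\<close>.\<close>
  obtain I where I: "I \<subseteq> C" "lin_inj C I M" "\<forall>i\<in>C - I. \<not> lin_inj C (insert i I) M"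
    using ex_maximal_subset[where Q = "\<lambda>I. lin_inj C I M", OF fin(1)] by auto
  have finI: "finite I" using I(1) fin(1) by (rule finite_subset)
  have "\<forall>v\<in>C. \<exists>c. \<forall>u\<in>C. M u v = (\<Sum>l\<in>I. M u l * c l)"
  proof
    fix v assume v: "v \<in> C"
    show "\<exists>c. \<forall>u\<in>C. M u v = (\<Sum>l\<in>I. M u l * c l)"
    proof (cases "v \<in> I")
      case True
      have "M u v = (\<Sum>l\<in>I. M u l * (if l = v then 1 else 0))" for u
        using True finI by (simp add: if_distrib cong: if_cong)
      then show ?thesis by (intro exI[of _ "\<lambda>l. if l = v then 1 else 0"]) blast
    next
      case False
      then show ?thesis using lin_inj_insert_dependent[OF finI I(2)] I(3) v by blast
    qed
  qed
  from bchoice[OF this] obtain g where g': "\<forall>v\<in>C. \<forall>u\<in>C. M u v = (\<Sum>l\<in>I. M u l * g v l)" ..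
  then have g: "M u v = (\<Sum>l\<in>I. M u l * g v l)" if "u \<in> C" "v \<in> C" for u v using that by blast
  have I_ne: "I \<noteq> {}" using g[OF nz(1,2)] nz(3) by auto
  have R0: "lin_inj C (J <+> ({} :: 'c set)) R"
  proof (rule lin_injI)
    fix z k assume z: "\<And>u. u \<in> C \<Longrightarrow> (\<Sum>k\<in>J <+> ({} :: 'c set). R u k * z k) = 0"
      and "k \<in> J <+> ({} :: 'c set)"
    then obtain j where j: "k = Inl j" "j \<in> J" by auto
    then show "z k = 0"
      using lin_injD[OF P _ j(2), of "\<lambda>j. z (Inl j)"] z sumR[of "{}"] by simp
  qed
  \<comment> \<open>\<open>I1\<close> completes the columns of \<open>P\<close> to a basis of the
    sum of both column spaces. A column of \<open>M\<close> in \<open>I - I1\<close> is then a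
    combination of columns in \<open>I1\<close> plus a vector in the column space of
    \<open>P\<close>; subtracting the combination leaves a vector of the intersection.\<close>
  obtain I1 where I1: "I1 \<subseteq> I" "lin_inj C (J <+> I1) R"
    "\<forall>i\<in>I - I1. \<not> lin_inj C (J <+> insert i I1) R"
    using ex_maximal_subset[where Q = "\<lambda>A. lin_inj C (J <+> A) R", OF finI R0] by blast
  have finI1: "finite I1" using I1(1) finI by (rule finite_subset)
  define I2 where "I2 = I - I1"
  have finI2: "finite I2" using finI by (simp add: I2_def)
  have "\<forall>i\<in>I2. \<exists>c. \<forall>u\<in>C. M u i = (\<Sum>k\<in>J <+> I1. R u k * c k)"
  proof
    fix i assume i: "i \<in> I2"
    have "\<not> lin_inj C (J <+> insert i I1) R" using I1(3) i by (auto simp only: I2_def)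
    moreover have "J <+> insert i I1 = insert (Inr i) (J <+> I1)" by auto
    ultimately have "\<not> lin_inj C (insert (Inr i) (J <+> I1)) R" by simp
    then obtain c where "\<forall>u\<in>C. R u (Inr i) = (\<Sum>k\<in>J <+> I1. R u k * c k)"
      using lin_inj_insert_dependent[OF finite_Plus[OF fin(2) finI1] I1(2)] by blast
    then show "\<exists>c. \<forall>u\<in>C. M u i = (\<Sum>k\<in>J <+> I1. R u k * c k)"
      by (intro exI[of _ c]) (simp add: R_def)
  qed
  from bchoice[OF this] obtain c where
    c': "\<forall>i\<in>I2. \<forall>u\<in>C. M u i = (\<Sum>k\<in>J <+> I1. R u k * c i k)" ..
  then have c: "M u i = (\<Sum>k\<in>J <+> I1. R u k * c i k)" if "i \<in> I2" "u \<in> C" for i u using that by blast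
  define x where "x i j = c i (Inl j)" for i j
  define b where "b i l = c i (Inr l)" for i l
  have x: "(\<Sum>j\<in>J. P u j * x i j) = M u i - (\<Sum>l\<in>I1. M u l * b i l)" if "i \<in> I2" "u \<in> C" for i u
    using c[OF that] sumR[OF finI1] by (simp add: x_def b_def)
  have injx: "lin_inj J I2 (\<lambda>j i. x i j)"
  proof (rule lin_injI)
    fix y i assume y: "\<And>j. j \<in> J \<Longrightarrow> (\<Sum>i\<in>I2. x i j * y i) = 0" and i: "i \<in> I2"
    \<comment> \<open>A relation \<open>y\<close> among the vectors \<open>x i\<close> becomes a
      relation \<open>z\<close> among the basis columns of \<open>M\<close>, with the subtracted
      combinations collected on \<open>I1\<close>.\<close>
    define z where "z l = (if l \<in> I2 then y l else - (\<Sum>i\<in>I2. b i l * y i))" for l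
    have "(\<Sum>l\<in>I. M u l * z l) = 0" if u: "u \<in> C" for u
    proof -
      have "0 = (\<Sum>j\<in>J. P u j * (\<Sum>i\<in>I2. x i j * y i))" using y by simp
      also have "\<dots> = (\<Sum>i\<in>I2. (\<Sum>j\<in>J. P u j * x i j) * y i)"
        unfolding sum_distrib_left sum_distrib_right by (subst sum.swap) (simp add: mult.assoc)
      also have "\<dots> = (\<Sum>i\<in>I2. M u i * y i - (\<Sum>l\<in>I1. M u l * (b i l * y i)))"
        using u by (intro sum.cong refl) (simp add: x left_diff_distrib sum_distrib_right mult.assoc)
      also have "\<dots> = (\<Sum>i\<in>I2. M u i * y i) + (\<Sum>l\<in>I1. M u l * - (\<Sum>i\<in>I2. b i l * y i))"
        unfolding sum_subtractf by (subst sum.swap) (simp add: sum_distrib_left sum_negf)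
      also have "\<dots> = (\<Sum>l\<in>I2. M u l * z l) + (\<Sum>l\<in>I1. M u l * z l)"
        by (intro arg_cong2[where f = "(+)"] sum.cong refl) (auto simp: z_def I2_def)
      also have "\<dots> = (\<Sum>l\<in>I. M u l * z l)"
        unfolding I2_def using I1(1) finI by (simp add: sum.subset_diff)
      finally show ?thesis by simp
    qed
    then have "z i = 0" using lin_injD[OF I(2), of z i] i by (auto simp: I2_def)
    then show "y i = 0" using i by (simp add: z_def)
  qed
  \<comment> \<open>Otherwise the vectors \<open>\<zeta> i\<close>, orthogonal to \<open>P\<close>
    and dual to the columns \<open>I1\<close> of \<open>M\<close>, have a nontrivial combination
    \<open>z\<close> such that \<open>M z\<close> has no component on \<open>I2\<close>.
    Orthogonality also gives \<open>M z = P \<beta>\<close>, so independence of \<open>P\<close> and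
    \<open>I1\<close> yields \<open>M z = 0\<close>. But the entries of \<open>M z\<close> on
    \<open>I1\<close> are the coefficients \<open>a\<close>.\<close>
  have card: "card I1 \<le> card I2"
  proof (rule ccontr)
    assume "\<not> ?thesis"
    then have less: "card I2 < card I1" by simp
    have finR: "finite (J <+> I1)" using fin finI1 by simp
    obtain L where L: "\<And>k k'. k \<in> J <+> I1 \<Longrightarrow> k' \<in> J <+> I1 \<Longrightarrow> (\<Sum>u\<in>C. L k u * R u k') = (if k = k' then 1 else 0)"
      using lin_inj_left_inverse[OF fin(1) finR I1(2)] by blast
    define \<zeta> where "\<zeta> i u = L (Inr i) u" for i u
    have \<zeta>P: "(\<Sum>u\<in>C. P u j * \<zeta> i u) = 0" if "i \<in> I1" "j \<in> J" for i j
      using L[of "Inr i" "Inl j"] that by (simp add: \<zeta>_def R_def mult.commute InlI InrI)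
    have \<zeta>M: "(\<Sum>u\<in>C. M u l * \<zeta> i u) = (if i = l then 1 else 0)" if "i \<in> I1" "l \<in> I1" for i l
      using L[of "Inr i" "Inr l"] that by (simp add: \<zeta>_def R_def mult.commute InrI)
    \<comment> \<open>The coefficient of basis column \<open>l\<close> in \<open>M\<close> applied
      to \<open>\<zeta> i\<close>.\<close>
    define y where "y i l = (\<Sum>v\<in>C. g v l * \<zeta> i v)" for i l
    obtain a where a: "\<exists>i\<in>I1. a i \<noteq> 0" "\<And>l. l \<in> I2 \<Longrightarrow> (\<Sum>i\<in>I1. y i l * a i) = 0"
      using underdetermined_solution[OF real_subfield_UNIV finI2 finI1 less, of "\<lambda>l i. y i l"] by auto
    define z where "z u = (\<Sum>i\<in>I1. \<zeta> i u * a i)" for u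
    have zP: "(\<Sum>u\<in>C. P u j * z u) = 0" if "j \<in> J" for j
    proof -
      have "(\<Sum>u\<in>C. P u j * z u) = (\<Sum>i\<in>I1. (\<Sum>u\<in>C. P u j * \<zeta> i u) * a i)"
        unfolding z_def sum_distrib_left sum_distrib_right by (subst sum.swap) (simp add: mult.assoc)
      then show ?thesis using \<zeta>P that by simp
    qed
    have zM: "(\<Sum>v\<in>C. M u v * z v) = a u" if "u \<in> I1" for u
    proof -
      have "u \<in> C" using that I1 I by auto
      \<comment> \<open>Duality concerns columns of \<open>M\<close>, while \<open>M z\<close> is
        formed along rows; the symmetry of \<open>M\<close> connects them.\<close>
      have "(\<Sum>v\<in>C. M u v * z v) = (\<Sum>v\<in>C. M v u * z v)"
        using M[OF \<open>u \<in> C\<close>] M[OF _ \<open>u \<in> C\<close>] by (intro sum.cong refl) (simp add: algebra_simps)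
      also have "\<dots> = (\<Sum>i\<in>I1. (\<Sum>v\<in>C. M v u * \<zeta> i v) * a i)"
        unfolding z_def sum_distrib_left sum_distrib_right by (subst sum.swap) (simp add: mult.assoc)
      also have "\<dots> = (\<Sum>i\<in>I1. (if i = u then a i else 0))"
        using \<zeta>M[OF _ that] by (intro sum.cong refl) auto
      finally show ?thesis using that finI1 by simp
    qed
    define \<beta> where "\<beta> j = (\<Sum>v\<in>C. B v j * z v)" for j
    have Mz: "(\<Sum>v\<in>C. M u v * z v) = (\<Sum>j\<in>J. P u j * \<beta> j)" if u: "u \<in> C" for u
    proof -
      have "(\<Sum>v\<in>C. M u v * z v) = (\<Sum>v\<in>C. (\<Sum>j\<in>J. P u j * (B v j * z v)) + (\<Sum>j\<in>J. B u j * (P v j * z v)))"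
        by (intro sum.cong refl) (simp add: M[OF u] sum_distrib_right sum.distrib distrib_right mult.assoc)
      also have "\<dots> = (\<Sum>j\<in>J. P u j * \<beta> j) + (\<Sum>j\<in>J. B u j * (\<Sum>v\<in>C. P v j * z v))"
        by (simp only: sum.distrib \<beta>_def sum_swap_left)
      finally show ?thesis using zP by simp
    qed
    have Mz': "(\<Sum>v\<in>C. M u v * z v) = (\<Sum>l\<in>I1. M u l * (\<Sum>i\<in>I1. y i l * a i))" if u: "u \<in> C" for u
    proof -
      have yz: "(\<Sum>v\<in>C. g v l * z v) = (\<Sum>i\<in>I1. y i l * a i)" for l
        unfolding y_def z_def sum_distrib_left sum_distrib_right by (subst sum.swap) (simp add: mult.assoc)
      have "(\<Sum>v\<in>C. M u v * z v) = (\<Sum>v\<in>C. \<Sum>l\<in>I. M u l * (g v l * z v))"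
        using g[OF u] by (intro sum.cong refl) (simp add: sum_distrib_right mult.assoc)
      also have "\<dots> = (\<Sum>l\<in>I. M u l * (\<Sum>v\<in>C. g v l * z v))"
        by (subst sum.swap) (simp add: sum_distrib_left)
      also have "\<dots> = (\<Sum>l\<in>I1. M u l * (\<Sum>v\<in>C. g v l * z v))"
        using a(2) I1(1) finI by (intro sum.mono_neutral_right) (auto simp: yz I2_def)
      finally show ?thesis by (simp add: yz)
    qed
    have \<beta>0: "\<beta> j = 0" if j: "j \<in> J" for j
    proof -
      define k where "k e = (case e of Inl j \<Rightarrow> \<beta> j | Inr l \<Rightarrow> - (\<Sum>i\<in>I1. y i l * a i))" for e
      have "k (Inl j) = 0"
      proof (rule lin_injD[OF I1(2)])
        fix u assume "u \<in> C"
        then show "(\<Sum>e\<in>J <+> I1. R u e * k e) = 0"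
          using Mz Mz' by (simp add: sumR[OF finI1] k_def sum_negf)
      qed (use j in auto)
      then show ?thesis by (simp add: k_def)
    qed
    have "a i = 0" if "i \<in> I1" for i
      using zM[OF that] Mz[of i] \<beta>0 that I1(1) I(1) by auto
    then show False using a(1) by auto
  qed
  have "I2 \<noteq> {}"
  proof
    assume "I2 = {}"
    then have "I1 = {}" using card finI1 by simp
    then show False using \<open>I2 = {}\<close> I_ne by (simp add: I2_def)
  qed
  show thesis
    by (rule that[of I1 I2 x b]) (use I1(1) I(1) I2_def \<open>I2 \<noteq> {}\<close> card x injx in auto)
qed

text \<open>A left inverse of \<open>P\<close> solves the relation as \<open>B = P A\<close>.
  Substituting back gives \<open>P (A + A^T) P^T = 0\<close>, and \<open>P\<close> cancels on both
  sides.\<close>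

lemma skew_symmetric_if_product_zero:
  fixes P B :: "'c \<Rightarrow> 'j \<Rightarrow> real"
  assumes fin: "finite C" "finite J" and P: "lin_inj C J P"
    and zero: "\<And>u v. u \<in> C \<Longrightarrow> v \<in> C \<Longrightarrow> (\<Sum>j\<in>J. P u j * B v j + B u j * P v j) = 0"
  obtains A where "\<And>i j. i \<in> J \<Longrightarrow> j \<in> J \<Longrightarrow> A i j = - A j i"
    "\<And>u j. u \<in> C \<Longrightarrow> j \<in> J \<Longrightarrow> B u j = (\<Sum>i\<in>J. P u i * A i j)"
proof -
  obtain L where L: "\<And>i j. i \<in> J \<Longrightarrow> j \<in> J \<Longrightarrow> (\<Sum>v\<in>C. L i v * P v j) = (if i = j then 1 else 0)"
    using lin_inj_left_inverse[OF fin P] by blast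
  define A where "A i j = - (\<Sum>v\<in>C. L j v * B v i)" for i j
  have B: "B u k = (\<Sum>j\<in>J. P u j * A j k)" if u: "u \<in> C" and k: "k \<in> J" for u k
  proof -
    have "0 = (\<Sum>v\<in>C. L k v * (\<Sum>j\<in>J. P u j * B v j + B u j * P v j))" using zero[OF u] by simp
    also have "\<dots> = (\<Sum>v\<in>C. (\<Sum>j\<in>J. P u j * (L k v * B v j)) + (\<Sum>j\<in>J. B u j * (L k v * P v j)))"
      by (simp add: sum_distrib_left sum.distrib[symmetric] algebra_simps)
    also have "\<dots> = (\<Sum>j\<in>J. P u j * (\<Sum>v\<in>C. L k v * B v j)) + (\<Sum>j\<in>J. B u j * (\<Sum>v\<in>C. L k v * P v j))"
      by (simp only: sum.distrib sum_swap_left)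
    also have "(\<Sum>j\<in>J. B u j * (\<Sum>v\<in>C. L k v * P v j)) = (\<Sum>j\<in>J. if k = j then B u j else 0)"
      by (intro sum.cong refl) (simp add: L[OF k])
    also have "\<dots> = B u k" using fin k by simp
    finally show ?thesis by (simp add: A_def sum_negf)
  qed
  have "A i j + A j i = 0" if i: "i \<in> J" and j: "j \<in> J" for i j
  proof -
    have "(\<Sum>j\<in>J. P v j * (\<Sum>i\<in>J. P u i * (A i j + A j i))) = 0" if u: "u \<in> C" and v: "v \<in> C" for u v
    proof -
      have "(\<Sum>j\<in>J. P u j * B v j) = (\<Sum>j\<in>J. \<Sum>i\<in>J. P v i * (P u j * A i j))"
        by (intro sum.cong refl) (simp add: B[OF v] sum_distrib_left mult_ac)
      also have "\<dots> = (\<Sum>j\<in>J. P v j * (\<Sum>i\<in>J. P u i * A j i))" by (rule sum_swap_left)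
      finally have 1: "(\<Sum>j\<in>J. P u j * B v j) = (\<Sum>j\<in>J. P v j * (\<Sum>i\<in>J. P u i * A j i))" .
      have 2: "(\<Sum>j\<in>J. B u j * P v j) = (\<Sum>j\<in>J. P v j * (\<Sum>i\<in>J. P u i * A i j))"
        using B[OF u] by (simp add: mult.commute)
      show ?thesis using zero[OF u v] 1 2 by (simp add: sum.distrib distrib_left)
    qed
    then have "(\<Sum>i\<in>J. P u i * (A i j + A j i)) = 0" if u: "u \<in> C" for u
      using lin_injD[OF P, of "\<lambda>j. \<Sum>i\<in>J. P u i * (A i j + A j i)" j] u j by auto
    then show ?thesis using lin_injD[OF P, of "\<lambda>i. A i j + A j i" i] i by auto
  qed
  then show thesis using that[of A] B by (metis eq_neg_iff_add_eq_0)
qed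

text \<open>A kernel vector with \<open>y s \<noteq> 0\<close> would give column \<open>s\<close>
  from the other columns and \<open>d\<close> ratios. Then \<open>card D * (d + 1)\<close>
  independent numbers would come from \<open>card D * d + d\<close>, which is too few once
  \<open>d < card D\<close>.\<close>

lemma generic_rows_lin_inj:
  fixes P :: "'c \<Rightarrow> nat \<Rightarrow> real"
  assumes ind: "algebraically_independent_over_rat (C \<times> {..d}) (\<lambda>(c, j). P c j)"
    and D: "D \<subseteq> C" "finite D" "d < card D"
  shows "lin_inj D {..d} P"
proof (rule lin_injI, rule ccontr)
  fix y s assume y: "\<And>u. u \<in> D \<Longrightarrow> (\<Sum>j\<le>d. P u j * y j) = 0" and s: "s \<in> {..d}" "y s \<noteq> 0"
  define S where "S = {..d} - {s}"
  have S: "finite S" "card S = d" "{..d} = insert s S" "s \<notin> S" using s by (auto simp: S_def)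
  define T where "T = (\<lambda>t. y t / y s) ` S \<union> (\<lambda>(u, t). P u t) ` (D \<times> S)"
  note K = real_subfield_rat_field[of T]
  have "P u j \<in> rat_field T" if u: "u \<in> D" and "j \<in> {..d}" for u j
  proof (cases "j = s")
    case True
    have "P u s * y s = - (\<Sum>t\<in>S. P u t * y t)" using y[OF u] S by simp
    then have "P u s = - (\<Sum>t\<in>S. P u t * (y t / y s))"
      using s by (simp add: field_simps sum_divide_distrib[symmetric])
    also have "\<dots> \<in> rat_field T"
      using u by (intro real_subfieldD(5)[OF K] real_subfield_sum[OF K] real_subfieldD(4)[OF K] rat_field.gen)
        (auto simp: T_def)
    finally show ?thesis using True by simp
  qed (use that S in \<open>auto intro!: rat_field.gen simp: T_def\<close>)
  then have "card (D \<times> {..d}) \<le> card T"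
    using D S algebraically_independent_subset[OF ind, of "D \<times> {..d}"]
    by (intro algebraically_independent_card_le) (auto simp: T_def)
  also have "card T \<le> d + card D * d"
    unfolding T_def using D S
    by (intro order.trans[OF card_Un_le] add_mono order.trans[OF card_image_le]) (auto simp: card_cartesian_product)
  finally show False using D by (simp add: card_cartesian_product)
qed

text \<open>
  If \<open>M\<close> were nonzero, then choosing the nonzero entries of a column basis of \<open>M\<close> and the
  coefficients of the intersection of the two column spaces would determine \<open>P\<close> by fewer
  parameters than it has entries.
\<close>

lemma generic_sparse_product_zero:
  fixes P B :: "'c \<Rightarrow> nat \<Rightarrow> real" and d :: nat
  defines "M \<equiv> \<lambda>u v. \<Sum>j\<le>d. P u j * B v j + B u j * P v j"
  assumes ind: "algebraically_independent_over_rat (C \<times> {..d}) (\<lambda>(c, j). P c j)"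
    and fin: "finite C"
    and supp: "\<And>u v. u \<in> C \<Longrightarrow> v \<in> C \<Longrightarrow> v \<notin> F u \<Longrightarrow> M u v = 0"
    and F: "\<And>u. u \<in> C \<Longrightarrow> finite (F u) \<and> card (F u) \<le> D"
    and large: "2 * D + 2 * d + 2 < card C" and uv: "u \<in> C" "v \<in> C"
  shows "M u v = 0"
proof (rule ccontr)
  assume nz: "M u v \<noteq> 0"
  have P: "lin_inj C {..d} P" using generic_rows_lin_inj[OF ind _ fin] large by simp
  have M: "M u v = (\<Sum>j\<le>d. P u j * B v j + B u j * P v j)" for u v by (simp add: M_def)
  obtain I1 I2 x b where I: "I1 \<subseteq> C" "I2 \<subseteq> C" "I2 \<noteq> {}" "card I1 \<le> card I2"
    and x: "\<And>i u. i \<in> I2 \<Longrightarrow> u \<in> C \<Longrightarrow> (\<Sum>j\<le>d. P u j * x i j) = M u i - (\<Sum>l\<in>I1. M u l * b i l)"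
    and injx: "lin_inj {..d} I2 (\<lambda>j i. x i j)"
    by (rule symmetric_product_intersection[where M = M and P = P and B = B and J = "{..d}",
        OF fin finite_atMost M P uv nz]) blast
  have finI: "finite I1" "finite I2" using I fin finite_subset by blast+
  \<comment> \<open>For each row of \<open>P\<close>, the equations indexed by \<open>I2\<close>
    form a square invertible system in its entries on \<open>S\<close>. These entries are the ones
    to be eliminated.\<close>
  obtain S where S: "S \<subseteq> {..d}" "card S = card I2" "lin_inj I2 S x"
    using lin_inj_square_submatrix[OF finI(2) finite_atMost injx] by blast
  have finS: "finite S" using S(1) finite_subset by blast
  \<comment> \<open>The parameters are the possibly nonzero entries in the chosen columns of
    \<open>M\<close>, the two families of coefficients of the intersection, and the columns of
    \<open>P\<close> outside \<open>S\<close>.\<close>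
  define T where "T = (\<lambda>(i, u). M u i) ` (SIGMA i:I1 \<union> I2. F i) \<union> (\<lambda>(i, l). b i l) ` (I2 \<times> I1)
    \<union> (\<lambda>(i, j). x i j) ` (I2 \<times> {..d}) \<union> (\<lambda>(u, j). P u j) ` (C \<times> ({..d} - S))"
  note K = real_subfield_rat_field[of T]
  have MT: "M u i \<in> rat_field T" if u: "u \<in> C" and i: "i \<in> I1 \<union> I2" for u i
  proof (cases "u \<in> F i")
    case True
    then show ?thesis using i by (intro rat_field.gen) (auto simp: T_def)
  next
    case False
    \<comment> \<open>\<open>F\<close> bounds the support of rows, whereas the chosen basis consists
      of columns.\<close>
    have "M u i = M i u" by (simp add: M_def algebra_simps)
    also have "\<dots> = 0" using supp[of i u] False u i I by auto
    finally show ?thesis by (simp add: real_subfieldD[OF K])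
  qed
  have PT: "P u j \<in> rat_field T" if "u \<in> C" "j \<le> d" "j \<notin> S" for u j
    using that by (intro rat_field.gen) (auto simp: T_def)
  have xT: "x i j \<in> rat_field T" if "i \<in> I2" "j \<le> d" for i j
    using that by (intro rat_field.gen) (auto simp: T_def)
  have bT: "b i l \<in> rat_field T" if "i \<in> I2" "l \<in> I1" for i l
    using that by (intro rat_field.gen) (auto simp: T_def)
  have PS: "P u s \<in> rat_field T" if u: "u \<in> C" and s: "s \<in> S" for u s
  proof (rule lin_inj_unique_in_subfield[OF K finI(2) finS S(2)[symmetric] _ S(3) _ s])
    fix i assume i: "i \<in> I2"
    have "(\<Sum>j\<le>d. P u j * x i j) = (\<Sum>j\<in>S. P u j * x i j) + (\<Sum>j\<in>{..d} - S. P u j * x i j)"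
      using sum.subset_diff[OF S(1)] by (simp add: add.commute)
    then have "(\<Sum>j\<in>S. x i j * P u j) =
        M u i - (\<Sum>l\<in>I1. M u l * b i l) - (\<Sum>j\<in>{..d} - S. P u j * x i j)"
      using x[OF i u] by (simp add: mult.commute)
    also have "\<dots> \<in> rat_field T"
      using i u by (intro real_subfield_diff[OF K] real_subfield_sum[OF K] real_subfieldD(4)[OF K] MT PT bT xT) auto
    finally show "(\<Sum>j\<in>S. x i j * P u j) \<in> rat_field T" .
  qed (use xT S(1) in auto)
  have finF: "finite (SIGMA i:I1 \<union> I2. F i)" using finI F I by (intro finite_SigmaI) auto
  then have finT: "finite T" using finI fin by (auto simp: T_def)
  have "card (C \<times> {..d}) \<le> card T"
    using algebraically_independent_card_le[OF ind _ finT] fin PS PT by fastforce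
  also have "card T \<le> card (SIGMA i:I1 \<union> I2. F i) + card (I2 \<times> I1) + card (I2 \<times> {..d}) + card (C \<times> ({..d} - S))"
    unfolding T_def using finI finF fin
    by (intro order.trans[OF card_Un_le] add_mono card_image_le) auto
  also have "card (SIGMA i:I1 \<union> I2. F i) \<le> 2 * card I2 * D"
  proof -
    have "card (SIGMA i:I1 \<union> I2. F i) = (\<Sum>i\<in>I1 \<union> I2. card (F i))" using finI F I by (intro card_SigmaI) auto
    also have "\<dots> \<le> (\<Sum>i\<in>I1 \<union> I2. D)" using F I by (intro sum_mono) auto
    also have "\<dots> = card (I1 \<union> I2) * D" by simp
    also have "\<dots> \<le> (2 * card I2) * D" using card_Un_le[of I1 I2] I(4) by (intro mult_right_mono) auto
    finally show ?thesis .
  qed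
  finally have count: "card C * (d + 1) \<le>
      2 * card I2 * D + card I2 * card I1 + card I2 * (d + 1) + card C * (d + 1 - card I2)"
    using S finS by (simp add: card_cartesian_product card_Diff_subset)
  have le: "card I2 \<le> d + 1" using card_mono[OF _ S(1)] S(2) by simp
  have "card C * (d + 1) = card C * card I2 + card C * (d + 1 - card I2)"
    using le by (simp flip: distrib_left)
  moreover have "card I2 * card I1 \<le> card I2 * card I2" using I(4) by simp
  ultimately have "card C * card I2 \<le> 2 * card I2 * D + card I2 * card I2 + card I2 * (d + 1)"
    using count by linarith
  then have "card I2 * card C \<le> card I2 * (2 * D + card I2 + (d + 1))"
    by (simp add: algebra_simps)
  moreover have "card I2 > 0" using I(3) finI by (simp add: card_gt_0_iff)
  \<comment> \<open>Eliminating one column of \<open>P\<close> saves \<open>card C\<close>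
    parameters and costs at most the right-hand side.\<close>
  ultimately have "card C \<le> 2 * D + card I2 + (d + 1)" using nat_mult_le_cancel1 by blast
  then show False using le large by simp
qed

section \<open>Infinitesimal rigidity\<close>

text \<open>Homogeneous coordinates with the 1 at index \<open>d\<close>: translations become
  linear, and \<open>lin_inj\<close> for these rows says that the points affinely span the
  space.\<close>

definition affine_row :: "nat \<Rightarrow> (nat \<Rightarrow> real) \<Rightarrow> nat \<Rightarrow> real" where
  "affine_row d x i = (if i < d then x i else 1)"

text \<open>Half the derivative of the squared distance between \<open>u\<close> and
  \<open>v\<close> under the velocities \<open>f\<close>.\<close>

definition edge_rate :: "nat \<Rightarrow> ('a \<Rightarrow> nat \<Rightarrow> real) \<Rightarrow> ('a \<Rightarrow> nat \<Rightarrow> real) \<Rightarrow> 'a \<Rightarrow> 'a \<Rightarrow> real" where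
  "edge_rate d x f u v = (\<Sum>l<d. (x u l - x v l) * (f u l - f v l))"

definition infinitesimal_motion ::
  "nat \<Rightarrow> ('a \<times> 'a) set \<Rightarrow> ('a \<Rightarrow> nat \<Rightarrow> real) \<Rightarrow> ('a \<Rightarrow> nat \<Rightarrow> real) \<Rightarrow> bool" where
  "infinitesimal_motion d E x f \<longleftrightarrow> (\<forall>(u, v)\<in>E. edge_rate d x f u v = 0)"

text \<open>
  Row \<open>d\<close> of the skew-symmetric matrix \<open>A\<close> is the translation part of the motion; its entries
  in column \<open>d\<close> do not matter.
\<close>

definition trivial_motion_on ::
  "nat \<Rightarrow> 'a set \<Rightarrow> ('a \<Rightarrow> nat \<Rightarrow> real) \<Rightarrow> ('a \<Rightarrow> nat \<Rightarrow> real) \<Rightarrow> bool" where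
  "trivial_motion_on d V x f \<longleftrightarrow>
     (\<exists>A. (\<forall>i\<le>d. \<forall>j\<le>d. A i j = - A j i) \<and>
          (\<forall>v\<in>V. \<forall>l<d. f v l = (\<Sum>i\<le>d. affine_row d (x v) i * A i l)))"

lemma sum_atMost_split: "(\<Sum>i\<le>d. g i) = (\<Sum>i<d. g i) + (g d :: real)" for d :: nat
  by (simp only: lessThan_Suc_atMost[symmetric] sum.lessThan_Suc)

text \<open>The translation part cancels in \<open>f u - f v\<close>, and the quadratic form of a
  skew-symmetric matrix vanishes.\<close>

lemma edge_rate_trivial_motion:
  assumes "trivial_motion_on d V x f" "u \<in> V" "v \<in> V"
  shows "edge_rate d x f u v = 0"
proof -
  obtain A where A: "\<forall>i\<le>d. \<forall>j\<le>d. A i j = - A j i"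
    "\<forall>v\<in>V. \<forall>l<d. f v l = (\<Sum>i\<le>d. affine_row d (x v) i * A i l)"
    using assms(1) unfolding trivial_motion_on_def by blast
  have affine: "(\<Sum>i\<le>d. affine_row d (x v) i * A i l) = (\<Sum>i<d. x v i * A i l) + A d l" for v l
    by (simp add: sum_atMost_split affine_row_def)
  define y where "y i = x u i - x v i" for i
  have fy: "f u l - f v l = (\<Sum>i<d. y i * A i l)" if "l < d" for l
    using A(2) assms(2,3) that by (simp add: affine y_def left_diff_distrib sum_subtractf)
  have rate: "edge_rate d x f u v = (\<Sum>l<d. \<Sum>i<d. y l * (y i * A i l))"
    by (simp add: edge_rate_def fy y_def[symmetric] sum_distrib_left)
  also have "\<dots> = (\<Sum>l<d. \<Sum>i<d. - (y i * (y l * A l i)))"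
  proof (intro sum.cong refl)
    fix l i assume "l \<in> {..<d}" "i \<in> {..<d}"
    then have "A i l = - A l i" using A(1) by (meson less_imp_le lessThan_iff)
    then show "y l * (y i * A i l) = - (y i * (y l * A l i))" by simp
  qed
  also have "\<dots> = - (\<Sum>l<d. \<Sum>i<d. y l * (y i * A i l))"
    by (subst sum.swap) (simp add: sum_negf)
  finally show ?thesis unfolding rate by (rule equal_neg_zero[THEN iffD1])
qed

section \<open>Rigidity matrix and openness of infinitesimal rigidity\<close>

text \<open>The rigidity matrix, with one row per arc and one column per coordinate of a
  vertex.\<close>

definition edge_matrix :: "('a \<Rightarrow> nat \<Rightarrow> real) \<Rightarrow> 'a \<times> 'a \<Rightarrow> 'a \<times> nat \<Rightarrow> real" where
  "edge_matrix x e c = (x (fst e) (snd c) - x (snd e) (snd c)) *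
     ((if fst c = fst e then 1 else 0) - (if fst c = snd e then 1 else 0))"

lemma edge_matrix_mult:
  assumes "finite V" "u \<in> V" "v \<in> V"
  shows "(\<Sum>c\<in>V \<times> {..<d}. edge_matrix x (u, v) c * f (fst c) (snd c)) = edge_rate d x f u v"
proof -
  have "(\<Sum>c\<in>V \<times> {..<d}. edge_matrix x (u, v) c * f (fst c) (snd c)) =
      (\<Sum>w\<in>V. \<Sum>l<d. edge_matrix x (u, v) (w, l) * f w l)"
    by (simp add: sum.cartesian_product')
  also have "\<dots> = (\<Sum>l<d. \<Sum>w\<in>V. edge_matrix x (u, v) (w, l) * f w l)" by (rule sum.swap)
  also have "\<dots> = (\<Sum>l<d. \<Sum>w\<in>V. (if w = u then (x u l - x v l) * f w l else 0) -
      (if w = v then (x u l - x v l) * f w l else 0))"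
    by (intro sum.cong refl) (auto simp: edge_matrix_def algebra_simps)
  also have "\<dots> = edge_rate d x f u v"
    using assms by (simp add: sum_subtractf edge_rate_def right_diff_distrib)
  finally show ?thesis .
qed

definition skew_index :: "nat \<Rightarrow> (nat \<times> nat) set" where
  "skew_index d = {(i, j). i < j \<and> j \<le> d}"

definition skew_of :: "(nat \<times> nat \<Rightarrow> real) \<Rightarrow> nat \<Rightarrow> nat \<Rightarrow> real" where
  "skew_of s i j = (if i < j then s (i, j) else if j < i then - s (j, i) else 0)"

text \<open>Sends the entries above the diagonal of a skew-symmetric matrix of size
  \<open>d + 1\<close> to the trivial motion that it generates. Only these entries are parameters,
  so that the map can be injective.\<close>

definition trivial_matrix :: "nat \<Rightarrow> ('a \<Rightarrow> nat \<Rightarrow> real) \<Rightarrow> 'a \<times> nat \<Rightarrow> nat \<times> nat \<Rightarrow> real" where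
  "trivial_matrix d x c q = (if snd c = snd q then affine_row d (x (fst c)) (fst q) else 0) -
     (if snd c = fst q then affine_row d (x (fst c)) (snd q) else 0)"

lemma finite_skew_index: "finite (skew_index d)"
  by (rule finite_subset[of _ "{..d} \<times> {..d}"]) (auto simp: skew_index_def)

lemma trivial_matrix_mult:
  assumes "l \<le> d"
  shows "(\<Sum>q\<in>skew_index d. trivial_matrix d x (v, l) q * s q) =
    (\<Sum>i\<le>d. affine_row d (x v) i * skew_of s i l)"
proof -
  let ?r = "affine_row d (x v)"
  have "(\<Sum>q\<in>skew_index d. trivial_matrix d x (v, l) q * s q) =
      (\<Sum>q\<in>{..d} \<times> {..d}. if fst q < snd q then trivial_matrix d x (v, l) q * s q else 0)"
    by (rule sum.mono_neutral_cong_left) (auto simp: skew_index_def)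
  also have "\<dots> = (\<Sum>i\<le>d. \<Sum>j\<le>d. if i < j then trivial_matrix d x (v, l) (i, j) * s (i, j) else 0)"
    by (simp add: sum.cartesian_product')
  also have "\<dots> = (\<Sum>i\<le>d. \<Sum>j\<le>d. (if j = l then if i < j then ?r i * s (i, j) else 0 else 0) -
      (if i = l then if i < j then ?r j * s (i, j) else 0 else 0))"
    by (intro sum.cong refl) (auto simp: trivial_matrix_def)
  also have "\<dots> = (\<Sum>i\<le>d. if i < l then ?r i * s (i, l) else 0) -
      (\<Sum>i\<le>d. \<Sum>j\<le>d. (if i = l then if i < j then ?r j * s (i, j) else 0 else 0))"
    using assms by (simp add: sum_subtractf)
  also have "(\<Sum>i\<le>d. \<Sum>j\<le>d. (if i = l then if i < j then ?r j * s (i, j) else 0 else 0)) =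
      (\<Sum>j\<le>d. if l < j then ?r j * s (l, j) else 0)"
    using assms by (subst sum.swap) simp
  also have "(\<Sum>i\<le>d. if i < l then ?r i * s (i, l) else 0) - (\<Sum>j\<le>d. if l < j then ?r j * s (l, j) else 0) =
      (\<Sum>i\<le>d. ?r i * skew_of s i l)"
    unfolding sum_subtractf[symmetric] by (intro sum.cong refl) (auto simp: skew_of_def)
  finally show ?thesis .
qed

lemma skew_of_skew: "skew_of s i j = - skew_of s j i"
  by (auto simp: skew_of_def)

lemma skew_of_upper:
  assumes "\<forall>i\<le>d. \<forall>j\<le>d. A i j = - A j i" "i \<le> d" "l \<le> d"
  shows "skew_of (\<lambda>(i, j). A i j) i l = A i l"
proof -
  have "A l i = - A i l" using assms by blast
  then show ?thesis by (cases i l rule: linorder_cases) (auto simp: skew_of_def)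
qed

text \<open>Skew matrices, velocities and edge rates form the sequence of
  \<open>exact_sequence_open\<close>. Affine spanning makes the first map injective, so the trivial
  motions keep their dimension under perturbation.\<close>

lemma infinitesimal_rigidity_open:
  assumes V: "finite V" and E: "E \<subseteq> V \<times> V"
    and exact: "\<And>f. infinitesimal_motion d E p f \<Longrightarrow> trivial_motion_on d V p f"
    and inj: "lin_inj V {..d} (\<lambda>v. affine_row d (p v))"
  obtains \<eta> where "\<eta> > 0"
    "\<And>x. (\<forall>v\<in>V. \<forall>i<d. \<bar>x v i - p v i\<bar> < \<eta>) \<Longrightarrow> lin_inj V {..d} (\<lambda>v. affine_row d (x v))"
    "\<And>x f. (\<forall>v\<in>V. \<forall>i<d. \<bar>x v i - p v i\<bar> < \<eta>) \<Longrightarrow> infinitesimal_motion d E x f \<Longrightarrow>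
      trivial_motion_on d V x f"
proof -
  define X where "X = V \<times> {..<d}"
  have finE: "finite E" using E V by (meson finite_SigmaI finite_subset)
  have finX: "finite X" using V by (simp add: X_def)
  have motion: "infinitesimal_motion d E x f \<longleftrightarrow>
      (\<forall>e\<in>E. (\<Sum>c\<in>X. edge_matrix x e c * f (fst c) (snd c)) = 0)" for x f
    unfolding infinitesimal_motion_def X_def
  proof (intro ball_cong refl)
    fix e assume "e \<in> E"
    then obtain u v where e: "e = (u, v)" "u \<in> V" "v \<in> V" using E by auto
    show "(case e of (u, v) \<Rightarrow> edge_rate d x f u v = 0) \<longleftrightarrow>
        (\<Sum>c\<in>V \<times> {..<d}. edge_matrix x e c * f (fst c) (snd c)) = 0"
      using edge_matrix_mult[OF V e(2,3)] e(1) by simp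
  qed
  have trivial: "trivial_motion_on d V x f"
    if "\<forall>c\<in>X. f (fst c) (snd c) = (\<Sum>q\<in>skew_index d. trivial_matrix d x c q * s q)" for x f s
    unfolding trivial_motion_on_def
  proof (intro exI[of _ "skew_of s"] conjI ballI allI impI)
    fix v l assume "v \<in> V" "l < d"
    then show "f v l = (\<Sum>i\<le>d. affine_row d (x v) i * skew_of s i l)"
      using that trivial_matrix_mult[of l d x v s] by (auto simp: X_def)
  qed (rule skew_of_skew)
  have exact': "\<exists>s. \<forall>c\<in>X. f c = (\<Sum>q\<in>skew_index d. trivial_matrix d p c q * s q)"
    if "\<And>e. e \<in> E \<Longrightarrow> (\<Sum>c\<in>X. edge_matrix p e c * f c) = 0" for f
  proof -
    have "infinitesimal_motion d E p (\<lambda>v l. f (v, l))" using that by (simp add: motion)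
    from exact[OF this] obtain A where A: "\<forall>i\<le>d. \<forall>j\<le>d. A i j = - A j i"
      "\<forall>v\<in>V. \<forall>l<d. f (v, l) = (\<Sum>i\<le>d. affine_row d (p v) i * A i l)"
      unfolding trivial_motion_on_def by blast
    have "f (v, l) = (\<Sum>q\<in>skew_index d. trivial_matrix d p (v, l) q * (\<lambda>(i, j). A i j) q)"
      if "v \<in> V" "l < d" for v l
      using that trivial_matrix_mult[of l d p v "\<lambda>(i, j). A i j"] A(2)
      by (simp add: skew_of_upper[OF A(1)])
    then show ?thesis by (intro exI[of _ "\<lambda>(i, j). A i j"]) (auto simp: X_def)
  qed
  have injT: "lin_inj X (skew_index d) (trivial_matrix d p)"
  proof (rule lin_injI)
    fix s q assume s: "\<And>c. c \<in> X \<Longrightarrow> (\<Sum>q\<in>skew_index d. trivial_matrix d p c q * s q) = 0"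
      and q: "q \<in> skew_index d"
    obtain i j where ij: "q = (i, j)" "i < j" "j \<le> d" using q by (auto simp: skew_index_def)
    \<comment> \<open>The entry \<open>(i, j)\<close> is read off from column \<open>i\<close>: as
      \<open>i < j\<close>, this is a velocity coordinate below \<open>d\<close>, which
      \<open>j\<close> need not be.\<close>
    have "(\<Sum>k\<le>d. affine_row d (p v) k * skew_of s k i) = 0" if "v \<in> V" for v
      using s[of "(v, i)"] that ij trivial_matrix_mult[of i d p v s] by (simp add: X_def)
    then have "skew_of s j i = 0" using lin_injD[OF inj, of "\<lambda>k. skew_of s k i" j] ij by auto
    then show "s q = 0" using ij by (simp add: skew_of_def)
  qed
  obtain \<delta> where \<delta>: "\<delta> > 0"
    "\<And>A' t' f. (\<And>e c. e \<in> E \<Longrightarrow> c \<in> X \<Longrightarrow> \<bar>A' e c - edge_matrix p e c\<bar> < \<delta>) \<Longrightarrow>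
       (\<And>c q. c \<in> X \<Longrightarrow> q \<in> skew_index d \<Longrightarrow> \<bar>t' c q - trivial_matrix d p c q\<bar> < \<delta>) \<Longrightarrow>
       (\<And>e q. e \<in> E \<Longrightarrow> q \<in> skew_index d \<Longrightarrow> (\<Sum>c\<in>X. A' e c * t' c q) = 0) \<Longrightarrow>
       (\<And>e. e \<in> E \<Longrightarrow> (\<Sum>c\<in>X. A' e c * f c) = 0) \<Longrightarrow>
       \<exists>s. \<forall>c\<in>X. f c = (\<Sum>q\<in>skew_index d. t' c q * s q)"
    by (rule exact_sequence_open[where A = "edge_matrix p" and t = "trivial_matrix d p",
        OF finE finX finite_skew_index exact' injT]) blast+
  obtain \<epsilon> where \<epsilon>: "\<epsilon> > 0"
    "\<And>R. (\<And>v i. v \<in> V \<Longrightarrow> i \<in> {..d} \<Longrightarrow> \<bar>R v i - affine_row d (p v) i\<bar> < \<epsilon>) \<Longrightarrow> lin_inj V {..d} R"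
    by (rule lin_inj_open[OF V finite_atMost inj]) blast
  show thesis
  \<comment> \<open>Half of \<open>\<delta>\<close>, because an entry of \<open>edge_matrix\<close>
    involves a difference of two coordinates.\<close>
  proof (rule that[of "min (\<delta> / 2) \<epsilon>"])
    show "min (\<delta> / 2) \<epsilon> > 0" using \<delta>(1) \<epsilon>(1) by simp
    fix x assume x: "\<forall>v\<in>V. \<forall>i<d. \<bar>x v i - p v i\<bar> < min (\<delta> / 2) \<epsilon>"
    show "lin_inj V {..d} (\<lambda>v. affine_row d (x v))"
      using x \<epsilon>(1) by (intro \<epsilon>(2)) (auto simp: affine_row_def)
    fix f assume f: "infinitesimal_motion d E x f"
    have row: "\<bar>affine_row d (x v) i - affine_row d (p v) i\<bar> < \<delta> / 2" if "v \<in> V" for v i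
      using x that \<delta>(1) by (auto simp: affine_row_def)
    have "\<exists>s. \<forall>c\<in>X. f (fst c) (snd c) = (\<Sum>q\<in>skew_index d. trivial_matrix d x c q * s q)"
    proof (rule \<delta>(2))
      fix e c assume e: "e \<in> E" and c: "c \<in> X"
      obtain u v w l where uv: "e = (u, v)" "c = (w, l)" "u \<in> V" "v \<in> V" "w \<in> V" "l < d"
        using e c E by (auto simp: X_def)
      have "\<bar>x u l - p u l\<bar> < \<delta> / 2" "\<bar>x v l - p v l\<bar> < \<delta> / 2" using x uv by auto
      then have "\<bar>(x u l - x v l) - (p u l - p v l)\<bar> < \<delta>" by linarith
      then show "\<bar>edge_matrix x e c - edge_matrix p e c\<bar> < \<delta>"
        using \<delta>(1) by (auto simp: edge_matrix_def uv abs_minus_commute)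
    next
      fix c q assume c: "c \<in> X" and q: "q \<in> skew_index d"
      obtain w l where w: "c = (w, l)" "w \<in> V" using c by (auto simp: X_def)
      show "\<bar>trivial_matrix d x c q - trivial_matrix d p c q\<bar> < \<delta>"
        using row[OF w(2), of "fst q"] row[OF w(2), of "snd q"] \<delta>(1) w(1)
        by (auto simp: trivial_matrix_def abs_if split: if_splits)
    next
      fix e q assume e: "e \<in> E" and q: "q \<in> skew_index d"
      obtain u v where uv: "e = (u, v)" "u \<in> V" "v \<in> V" using e E by auto
      \<comment> \<open>Column \<open>q\<close> of the perturbed matrix is itself a trivial motion,
        so all edge rates vanish on it.\<close>
      define g where "g w l = trivial_matrix d x (w, l) q" for w l
      have "\<forall>c\<in>X. g (fst c) (snd c) = (\<Sum>r\<in>skew_index d. trivial_matrix d x c r * (if r = q then 1 else 0))"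
        using q finite_skew_index by (simp add: g_def if_distrib cong: if_cong)
      from edge_rate_trivial_motion[OF trivial[OF this] uv(2,3)] have "edge_rate d x g u v = 0" .
      moreover have "(\<Sum>c\<in>X. edge_matrix x e c * g (fst c) (snd c)) = edge_rate d x g u v"
        unfolding uv(1) X_def by (rule edge_matrix_mult[OF V uv(2,3)])
      ultimately show "(\<Sum>c\<in>X. edge_matrix x e c * trivial_matrix d x c q) = 0" by (simp add: g_def)
    qed (use f[unfolded motion] in blast)
    then show "trivial_motion_on d V x f" using trivial by blast
  qed
qed

section \<open>Congruent frameworks and isometries\<close>

definition sq_dist :: "nat \<Rightarrow> (nat \<Rightarrow> real) \<Rightarrow> (nat \<Rightarrow> real) \<Rightarrow> real" where
  "sq_dist d x y = (\<Sum>i<d. (x i - y i)\<^sup>2)"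

lemma dist_in_eq_iff: "dist_in d x y = dist_in d x' y' \<longleftrightarrow> sq_dist d x y = sq_dist d x' y'"
  by (simp add: dist_in_def L2_set_def sq_dist_def)

text \<open>Polarisation: for weights with sum zero the squared norms cancel and only inner products
  remain. Hence distances determine the Gram matrix of all such combinations.\<close>

lemma gram_from_sq_dist:
  assumes "sum a V = 0" "sum b V = 0"
  shows "(\<Sum>l<d. (\<Sum>v\<in>V. a v * q v l) * (\<Sum>w\<in>V. b w * q w l)) =
    - (\<Sum>v\<in>V. \<Sum>w\<in>V. a v * b w * sq_dist d (q v) (q w)) / 2"
proof -
  define n where "n v = (\<Sum>l<d. (q v l)\<^sup>2)" for v
  define g where "g v w = (\<Sum>l<d. q v l * q w l)" for v w
  have sq: "sq_dist d (q v) (q w) = n v + n w - 2 * g v w" for v w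
    unfolding sq_dist_def n_def g_def sum_distrib_left sum.distrib[symmetric] sum_subtractf[symmetric]
    by (intro sum.cong refl) (simp add: power2_diff mult.assoc)
  have "(\<Sum>l<d. (\<Sum>v\<in>V. a v * q v l) * (\<Sum>w\<in>V. b w * q w l)) =
      (\<Sum>l<d. \<Sum>v\<in>V. \<Sum>w\<in>V. a v * b w * (q v l * q w l))"
    unfolding sum_product by (intro sum.cong refl) (simp add: mult_ac)
  also have "\<dots> = (\<Sum>v\<in>V. \<Sum>l<d. \<Sum>w\<in>V. a v * b w * (q v l * q w l))" by (rule sum.swap)
  also have "\<dots> = (\<Sum>v\<in>V. \<Sum>w\<in>V. a v * b w * g v w)"
    unfolding g_def sum_distrib_left by (intro sum.cong refl) (rule sum.swap)
  finally have 1: "(\<Sum>l<d. (\<Sum>v\<in>V. a v * q v l) * (\<Sum>w\<in>V. b w * q w l)) = \<dots>" .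
  have "(\<Sum>v\<in>V. \<Sum>w\<in>V. a v * b w * sq_dist d (q v) (q w)) =
      (\<Sum>v\<in>V. \<Sum>w\<in>V. (a v * n v) * b w) + (\<Sum>v\<in>V. \<Sum>w\<in>V. a v * (b w * n w))
      - 2 * (\<Sum>v\<in>V. \<Sum>w\<in>V. a v * b w * g v w)"
    unfolding sum_distrib_left[of 2] sum.distrib[symmetric] sum_subtractf[symmetric]
    by (intro sum.cong refl) (simp add: sq algebra_simps)
  also have "(\<Sum>v\<in>V. \<Sum>w\<in>V. (a v * n v) * b w) = 0" using assms by (simp flip: sum_product)
  also have "(\<Sum>v\<in>V. \<Sum>w\<in>V. a v * (b w * n w)) = 0" using assms by (simp flip: sum_product)
  finally show ?thesis using 1 by simp
qed

text \<open>A left inverse \<open>L\<close> writes the standard frame in terms of the points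
  \<open>p\<close>: weights \<open>L j\<close> with sum 0 for the direction \<open>j < d\<close>,
  and \<open>L d\<close> with sum 1 for the origin. Since Gram matrices agree, the same weights
  applied to \<open>q\<close> give an orthonormal frame \<open>a j\<close> at the point
  \<open>a d\<close>.\<close>

lemma isometry_of_congruent:
  assumes V: "finite V" and inj: "lin_inj V {..d} (\<lambda>v. affine_row d (p v))"
    and cong: "\<And>u v. u \<in> V \<Longrightarrow> v \<in> V \<Longrightarrow> sq_dist d (q u) (q v) = sq_dist d (p u) (p v)"
  obtains a b where "\<And>v j. v \<in> V \<Longrightarrow> j < d \<Longrightarrow> (\<Sum>i<d. (q v i - b i) * a j i) = p v j"
    "\<And>z. (\<Sum>j<d. (\<Sum>i<d. z i * a j i)\<^sup>2) = (\<Sum>i<d. (z i)\<^sup>2)"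
proof -
  obtain L where L: "\<And>j i. j \<in> {..d} \<Longrightarrow> i \<in> {..d} \<Longrightarrow>
      (\<Sum>v\<in>V. L j v * affine_row d (p v) i) = (if j = i then 1 else 0)"
    by (rule lin_inj_left_inverse[OF V finite_atMost inj]) blast
  have Lp: "(\<Sum>v\<in>V. L j v * p v i) = (if j = i then 1 else 0)" if "j \<le> d" "i < d" for i j
    using L[of j i] that by (simp add: affine_row_def)
  have L1: "(\<Sum>v\<in>V. L j v) = (if j = d then 1 else 0)" if "j \<le> d" for j
    using L[of j d] that by (simp add: affine_row_def)
  have gram: "(\<Sum>l<d. (\<Sum>v\<in>V. a v * q v l) * (\<Sum>w\<in>V. b w * q w l)) =
      (\<Sum>l<d. (\<Sum>v\<in>V. a v * p v l) * (\<Sum>w\<in>V. b w * p w l))"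
    if "sum a V = 0" "sum b V = 0" for a b
    unfolding gram_from_sq_dist[OF that] by (intro arg_cong[where f = "\<lambda>s. - s / 2"] sum.cong refl) (simp add: cong)
  define a where "a j i = (\<Sum>v\<in>V. L j v * q v i)" for j i
  have orth: "(\<Sum>l<d. a i l * a j l) = (if i = j then 1 else 0)" if "i < d" "j < d" for i j
  proof -
    have "(\<Sum>l<d. a i l * a j l) = (\<Sum>l<d. (\<Sum>v\<in>V. L i v * p v l) * (\<Sum>w\<in>V. L j w * p w l))"
      unfolding a_def using that by (intro gram) (auto simp: L1)
    also have "\<dots> = (\<Sum>l<d. if l = i then (if i = j then 1 else 0) else 0)"
      using that by (intro sum.cong refl) (auto simp: Lp)
    finally show ?thesis using that by simp
  qed
  have repr: "q v l - a d l = (\<Sum>j<d. p v j * a j l)" if v: "v \<in> V" and l: "l < d" for v l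
  proof -
    \<comment> \<open>The affine dependency among the points \<open>p\<close> that expresses vertex
      \<open>v\<close> in the frame. Equal Gram matrices make it a dependency among the points
      \<open>q\<close> as well.\<close>
    define c where "c u = (if u = v then 1 else 0) - L d u - (\<Sum>j<d. p v j * L j u)" for u
    have csum: "(\<Sum>u\<in>V. c u * y u) = y v - (\<Sum>u\<in>V. L d u * y u) - (\<Sum>j<d. p v j * (\<Sum>u\<in>V. L j u * y u))" for y
    proof -
      have "(\<Sum>u\<in>V. c u * y u) = (\<Sum>u\<in>V. if u = v then y u else 0) - (\<Sum>u\<in>V. L d u * y u)
          - (\<Sum>u\<in>V. \<Sum>j<d. p v j * (L j u * y u))"
        unfolding sum_subtractf[symmetric]
        by (intro sum.cong refl) (simp add: c_def sum_distrib_right left_diff_distrib mult.assoc)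
      also have "(\<Sum>u\<in>V. \<Sum>j<d. p v j * (L j u * y u)) = (\<Sum>j<d. p v j * (\<Sum>u\<in>V. L j u * y u))"
        by (subst sum.swap) (simp add: sum_distrib_left)
      finally show ?thesis using v V by simp
    qed
    have "sum c V = 0" using csum[of "\<lambda>_. 1"] by (simp add: L1)
    moreover have "(\<Sum>u\<in>V. c u * p u i) = 0" if "i < d" for i
      using csum[of "\<lambda>u. p u i"] that by (simp add: Lp if_distrib cong: if_cong)
    ultimately have "(\<Sum>l<d. (\<Sum>u\<in>V. c u * q u l) * (\<Sum>u\<in>V. c u * q u l)) = 0"
      by (simp add: gram)
    then have "(\<Sum>u\<in>V. c u * q u l) = 0" using l by (subst (asm) sum_nonneg_eq_0_iff) auto
    then show ?thesis using csum[of "\<lambda>u. q u l"] by (simp add: a_def)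
  qed
  have inner: "(\<Sum>l<d. (\<Sum>i<d. c i * a i l) * a j l) = c j" if "j < d" for c j
  proof -
    have "(\<Sum>l<d. (\<Sum>i<d. c i * a i l) * a j l) = (\<Sum>i<d. c i * (\<Sum>l<d. a i l * a j l))"
      unfolding sum_distrib_right sum_distrib_left by (subst sum.swap) (simp add: mult.assoc)
    also have "\<dots> = (\<Sum>i<d. if i = j then c i else 0)"
      using that by (intro sum.cong refl) (auto simp: orth)
    finally show ?thesis using that by simp
  qed
  show thesis
  proof (rule that[of "a d" a])
    show "(\<Sum>i<d. (q v i - a d i) * a j i) = p v j" if "v \<in> V" "j < d" for v j
      using inner[OF that(2), of "p v"] repr[OF that(1)] by simp
    show "(\<Sum>j<d. (\<Sum>i<d. z i * a j i)\<^sup>2) = (\<Sum>i<d. (z i)\<^sup>2)" for z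
    proof -
      \<comment> \<open>The \<open>d\<close> orthonormal vectors also span, which Parseval's
        identity needs.\<close>
      have "lin_inj {..<d} {..<d} (\<lambda>l j. a j l)"
      proof (rule lin_injI)
        fix c j assume c: "\<And>l. l \<in> {..<d} \<Longrightarrow> (\<Sum>j<d. a j l * c j) = 0" and "j \<in> {..<d}"
        then show "c j = 0" using inner[of j c] by (simp add: mult.commute)
      qed
      from lin_inj_solution[OF finite_lessThan finite_lessThan refl this, of z]
      obtain c where c: "\<And>l. l < d \<Longrightarrow> (\<Sum>j<d. a j l * c j) = z l" by auto
      have z: "z l = (\<Sum>i<d. c i * a i l)" if "l < d" for l using c[OF that] by (simp add: mult.commute)
      have zc: "(\<Sum>i<d. z i * a j i) = c j" if "j < d" for j using inner[OF that, of c] by (simp add: z)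
      have "(\<Sum>i<d. (z i)\<^sup>2) = (\<Sum>i<d. \<Sum>j<d. c j * (z i * a j i))"
        by (intro sum.cong refl) (simp add: power2_eq_square z[symmetric] sum_distrib_left mult_ac, simp add: z sum_distrib_left mult_ac)
      also have "\<dots> = (\<Sum>j<d. c j * (\<Sum>i<d. z i * a j i))"
        by (subst sum.swap) (simp add: sum_distrib_left)
      also have "\<dots> = (\<Sum>j<d. (\<Sum>i<d. z i * a j i)\<^sup>2)" by (simp add: zc power2_eq_square)
      finally show ?thesis by simp
    qed
  qed
qed

section \<open>From infinitesimal to continuous rigidity\<close>

text \<open>
  If \<open>p\<close> and \<open>q\<close> have the same edge lengths, then \<open>q - p\<close> is an infinitesimal motion of
  the midpoint framework, since \<open>(x + y) \<bullet> (x - y) = |x|\<^sup>2 - |y|\<^sup>2\<close>. Infinitesimal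
  rigidity near \<open>p\<close> therefore makes the set of times at which the motion is congruent to \<open>p\<close>
  open.
\<close>

lemma edge_rate_midpoint:
  "edge_rate d (\<lambda>v l. (p v l + q v l) / 2) (\<lambda>v l. q v l - p v l) u v =
    (sq_dist d (q u) (q v) - sq_dist d (p u) (p v)) / 2"
  unfolding edge_rate_def sq_dist_def sum_subtractf[symmetric] sum_divide_distrib
  by (intro sum.cong refl) (simp add: power2_eq_square field_simps)

lemma rigid_framework_if_infinitesimally_rigid:
  fixes p :: "'a \<Rightarrow> nat \<Rightarrow> real"
  assumes V: "finite (pverts G)" and E: "parcs G \<subseteq> pverts G \<times> pverts G"
    and exact: "\<And>f. infinitesimal_motion d (parcs G) p f \<Longrightarrow> trivial_motion_on d (pverts G) p f"
    and inj: "lin_inj (pverts G) {..d} (\<lambda>v. affine_row d (p v))"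
  shows "rigid_framework d G p"
  unfolding rigid_framework_def
proof (intro allI impI)
  fix m assume m: "continuous_motion d G p m \<and>
    (\<forall>t\<in>{0..1}. \<forall>(u, v)\<in>parcs G. dist_in d (m t u) (m t v) = dist_in d (p u) (p v))"
  define V where "V = pverts G"
  have finV: "finite V" using V by (simp add: V_def)
  have cont: "continuous_on {0..1} (\<lambda>t. m t v i)" if "v \<in> V" "i < d" for v i
    using m that by (auto simp: continuous_motion_def V_def)
  have start: "m 0 v i = p v i" if "v \<in> V" "i < d" for v i
    using m that by (auto simp: continuous_motion_def V_def)
  have edges: "sq_dist d (m t u) (m t v) = sq_dist d (p u) (p v)" if "t \<in> {0..1}" "(u, v) \<in> parcs G" for t u v
    using m that by (auto simp: dist_in_eq_iff)
  obtain \<eta> where \<eta>: "\<eta> > 0"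
    "\<And>x f. (\<forall>v\<in>V. \<forall>i<d. \<bar>x v i - p v i\<bar> < \<eta>) \<Longrightarrow> infinitesimal_motion d (parcs G) x f \<Longrightarrow>
      trivial_motion_on d V x f"
    unfolding V_def by (rule infinitesimal_rigidity_open[OF V E exact inj]) blast+
  define T where "T = {t \<in> {0..1}. \<forall>u\<in>V. \<forall>v\<in>V. sq_dist d (m t u) (m t v) = sq_dist d (p u) (p v)}"
  define g where "g t = (\<Sum>u\<in>V. \<Sum>v\<in>V. \<bar>sq_dist d (m t u) (m t v) - sq_dist d (p u) (p v)\<bar>)" for t
  have "continuous_on {0..1} g"
    unfolding g_def sq_dist_def by (intro continuous_intros cont) auto
  then have "closedin (top_of_set {0..1}) ({0..1} \<inter> g -` {0})"
    by (rule continuous_closedin_preimage) simp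
  moreover have "{0..1} \<inter> g -` {0} = T"
    using finV by (auto simp: T_def g_def sum_nonneg_eq_0_iff sum_nonneg)
  ultimately have closed: "closedin (top_of_set {0..1}) T" by simp
  have "openin (top_of_set {0..1}) T"
  proof (subst openin_subopen, rule ballI)
    fix t0 assume t0: "t0 \<in> T"
    then have cong: "\<And>u v. u \<in> V \<Longrightarrow> v \<in> V \<Longrightarrow> sq_dist d (m t0 u) (m t0 v) = sq_dist d (p u) (p v)"
      by (auto simp: T_def)
    obtain a b where ab: "\<And>v j. v \<in> V \<Longrightarrow> j < d \<Longrightarrow> (\<Sum>i<d. (m t0 v i - b i) * a j i) = p v j"
      and parseval: "\<And>z. (\<Sum>j<d. (\<Sum>i<d. z i * a j i)\<^sup>2) = (\<Sum>i<d. (z i)\<^sup>2)"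
      by (rule isometry_of_congruent[OF finV inj[folded V_def] cong]) blast+
    \<comment> \<open>\<open>q t\<close> is \<open>m t\<close> moved by the isometry that returns
      \<open>m t0\<close> to \<open>p\<close>. The single radius \<open>\<eta>\<close> around
      \<open>p\<close> thereby serves every time \<open>t0\<close>, however far the motion has
      gone.\<close>
    define q where "q t v j = (\<Sum>i<d. (m t v i - b i) * a j i)" for t v j
    have q_dist: "sq_dist d (q t u) (q t v) = sq_dist d (m t u) (m t v)" for t u v
    proof -
      have "q t u j - q t v j = (\<Sum>i<d. (m t u i - m t v i) * a j i)" for j
        unfolding q_def sum_subtractf[symmetric] by (intro sum.cong refl) (simp add: algebra_simps)
      then show ?thesis using parseval[of "\<lambda>i. m t u i - m t v i"] by (simp add: sq_dist_def)
    qed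
    define h where "h t = (\<Sum>v\<in>V. \<Sum>j<d. \<bar>q t v j - p v j\<bar>)" for t
    define W where "W = {0..1} \<inter> h -` {..<\<eta>}"
    have "continuous_on {0..1} h"
      unfolding h_def q_def by (intro continuous_intros cont) auto
    then have "openin (top_of_set {0..1}) W"
      unfolding W_def by (rule continuous_openin_preimage_gen) simp
    moreover have "h t0 = 0" using ab by (simp add: h_def q_def)
    then have "t0 \<in> W" using t0 \<eta>(1) by (auto simp: W_def T_def)
    moreover have "W \<subseteq> T"
    proof
      fix t assume "t \<in> W"
      then have t: "t \<in> {0..1}" "h t < \<eta>" by (auto simp: W_def)
      have near: "\<bar>q t v j - p v j\<bar> < \<eta>" if "v \<in> V" "j < d" for v j
      proof -
        have "\<bar>q t v j - p v j\<bar> \<le> (\<Sum>j<d. \<bar>q t v j - p v j\<bar>)"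
          using that by (intro member_le_sum) auto
        also have "\<dots> \<le> h t"
          unfolding h_def using that finV by (intro member_le_sum[of v V]) (auto intro: sum_nonneg)
        finally show ?thesis using t(2) by simp
      qed
      define x where "x v l = (p v l + q t v l) / 2" for v l
      define f where "f v l = q t v l - p v l" for v l
      have rate: "edge_rate d x f u v = (sq_dist d (q t u) (q t v) - sq_dist d (p u) (p v)) / 2" for u v
        unfolding x_def f_def by (rule edge_rate_midpoint)
      have x_near: "\<forall>v\<in>V. \<forall>i<d. \<bar>x v i - p v i\<bar> < \<eta>"
      proof (intro ballI allI impI)
        fix v i assume "v \<in> V" "i < d"
        then have "\<bar>q t v i - p v i\<bar> < \<eta>" by (rule near)
        moreover have "x v i - p v i = (q t v i - p v i) / 2" by (simp add: x_def field_simps)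
        ultimately show "\<bar>x v i - p v i\<bar> < \<eta>" by simp
      qed
      have "infinitesimal_motion d (parcs G) x f"
        using edges[OF t(1)] by (auto simp: infinitesimal_motion_def rate q_dist)
      from \<eta>(2)[OF x_near this] have trivial: "trivial_motion_on d V x f" .
      have "sq_dist d (m t u) (m t v) = sq_dist d (p u) (p v)" if "u \<in> V" "v \<in> V" for u v
        using edge_rate_trivial_motion[OF trivial that] rate[of u v] q_dist[of t u v] by simp
      then show "t \<in> T" using t(1) unfolding T_def by blast
    qed
    ultimately show "\<exists>W. openin (top_of_set {0..1}) W \<and> t0 \<in> W \<and> W \<subseteq> T" by blast
  qed
  moreover have "sq_dist d (m 0 u) (m 0 v) = sq_dist d (p u) (p v)" if "u \<in> V" "v \<in> V" for u v
    unfolding sq_dist_def using that by (intro sum.cong refl) (simp add: start)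
  then have "0 \<in> T" by (simp add: T_def)
  moreover have "connected {0..1::real}" by simp
  ultimately have "T = {0..1}" using closed unfolding connected_clopen by blast
  then show "\<forall>t\<in>{0..1}. \<forall>u\<in>pverts G. \<forall>v\<in>pverts G. dist_in d (m t u) (m t v) = dist_in d (p u) (p v)"
    by (auto simp: T_def dist_in_eq_iff V_def)
qed

section \<open>Random maps with large images\<close>

lemma card_funcset_into_subset:
  assumes "finite V" "W \<subseteq> V" "S \<subseteq> {..<m::nat}"
  shows "card {\<phi> \<in> V \<rightarrow>\<^sub>E {..<m}. \<phi> ` W \<subseteq> S} = card S ^ card W * m ^ (card V - card W)"
proof -
  have "{\<phi> \<in> V \<rightarrow>\<^sub>E {..<m}. \<phi> ` W \<subseteq> S} = (\<Pi>\<^sub>E v\<in>V. if v \<in> W then S else {..<m})"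
    using assms by (fastforce simp: PiE_iff extensional_def split: if_splits)
  then have "card {\<phi> \<in> V \<rightarrow>\<^sub>E {..<m}. \<phi> ` W \<subseteq> S} = (\<Prod>v\<in>V. if v \<in> W then card S else m)"
    using assms(1) by (simp add: card_PiE if_distrib cong: if_cong)
  also have "\<dots> = (\<Prod>v\<in>V - W. m) * (\<Prod>v\<in>W. card S)"
    using prod.subset_diff[OF assms(2,1), of "\<lambda>v. if v \<in> W then card S else m"] by simp
  also have "\<dots> = card S ^ card W * m ^ (card V - card W)"
    using assms finite_subset[OF assms(2,1)] by (simp add: card_Diff_subset)
  finally show ?thesis .
qed

text \<open>Union bound by counting maps: an image of size below \<open>s\<close> lies in some
  \<open>S\<close> with at most \<open>s\<close> elements, there are at most \<open>2 ^ m\<close>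
  such \<open>S\<close>, and at most a fraction \<open>(s / m) ^ \<kappa>\<close> of all maps sends
  a fixed \<open>W i\<close> into \<open>S\<close>.\<close>

lemma ex_map_with_large_images:
  fixes W :: "'i \<Rightarrow> 'a set"
  assumes V: "finite V" and I: "finite I" and W: "\<And>i. i \<in> I \<Longrightarrow> W i \<subseteq> V \<and> \<kappa> \<le> card (W i)"
    and s: "s \<le> m" "0 < m" and small: "real (card I) * 2 ^ m * (real s / real m) ^ \<kappa> < 1"
  obtains \<phi> where "\<phi> ` V \<subseteq> {..<m}" "\<And>i. i \<in> I \<Longrightarrow> s \<le> card (\<phi> ` W i)"
proof -
  define bad where "bad i S = {\<phi> \<in> V \<rightarrow>\<^sub>E {..<m}. \<phi> ` W i \<subseteq> S}" for i S
  define Ss where "Ss = {S. S \<subseteq> {..<m} \<and> card S \<le> s}"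
  have finS: "finite Ss" and cardS: "card Ss \<le> 2 ^ m"
  proof -
    have sub: "Ss \<subseteq> Pow {..<m}" by (auto simp: Ss_def)
    then show "finite Ss" by (rule finite_subset) simp
    show "card Ss \<le> 2 ^ m" using card_mono[OF _ sub] by (simp add: card_Pow)
  qed
  have finA: "finite (V \<rightarrow>\<^sub>E {..<m})" using V by (intro finite_PiE) auto
  have finB: "finite (bad i S)" for i S unfolding bad_def using finA by simp
  have bad: "real (card (bad i S)) \<le> (real s / real m) ^ \<kappa> * real m ^ card V"
    if i: "i \<in> I" and S: "S \<in> Ss" for i S
  proof -
    have le: "card (W i) \<le> card V" using W[OF i] V by (simp add: card_mono)
    have "real (card (bad i S)) = real (card S) ^ card (W i) * real m ^ (card V - card (W i))"
      unfolding bad_def using W[OF i] S V by (subst card_funcset_into_subset) (auto simp: Ss_def)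
    also have "\<dots> \<le> real s ^ card (W i) * real m ^ (card V - card (W i))"
      using S by (intro mult_right_mono power_mono) (auto simp: Ss_def)
    also have "\<dots> = (real s / real m) ^ card (W i) * real m ^ card V"
      using s le by (simp add: power_divide power_diff)
    also have "\<dots> \<le> (real s / real m) ^ \<kappa> * real m ^ card V"
      using s W[OF i] by (intro mult_right_mono power_decreasing) auto
    finally show ?thesis .
  qed
  have "card (\<Union>(i, S)\<in>I \<times> Ss. bad i S) \<le> (\<Sum>(i, S)\<in>I \<times> Ss. card (bad i S))"
    using card_UN_le[of "I \<times> Ss" "\<lambda>(i, S). bad i S"] I finS by (simp add: case_prod_unfold)
  then have "real (card (\<Union>(i, S)\<in>I \<times> Ss. bad i S)) \<le> (\<Sum>(i, S)\<in>I \<times> Ss. real (card (bad i S)))"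
    by (simp add: case_prod_unfold flip: of_nat_sum)
  also have "\<dots> \<le> (\<Sum>(i, S)\<in>I \<times> Ss. (real s / real m) ^ \<kappa> * real m ^ card V)"
    using bad by (intro sum_mono) auto
  also have "\<dots> = real (card I) * real (card Ss) * (real s / real m) ^ \<kappa> * real m ^ card V"
    by (simp add: card_cartesian_product case_prod_unfold)
  also have "\<dots> \<le> real (card I) * 2 ^ m * (real s / real m) ^ \<kappa> * real m ^ card V"
    using cardS by (intro mult_right_mono mult_left_mono) (auto simp: of_nat_le_iff[symmetric] simp del: of_nat_le_iff)
  also have "\<dots> < 1 * real m ^ card V"
    using small s by (intro mult_strict_right_mono) auto
  also have "\<dots> = real (card (V \<rightarrow>\<^sub>E {..<m}))" using V by (simp add: card_PiE)
  finally have "card (\<Union>(i, S)\<in>I \<times> Ss. bad i S) < card (V \<rightarrow>\<^sub>E {..<m})" by simp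
  then have "\<not> (V \<rightarrow>\<^sub>E {..<m}) \<subseteq> (\<Union>(i, S)\<in>I \<times> Ss. bad i S)"
    using card_mono[of "\<Union>(i, S)\<in>I \<times> Ss. bad i S" "V \<rightarrow>\<^sub>E {..<m}"] I finS finB by force
  then obtain \<phi> where \<phi>: "\<phi> \<in> V \<rightarrow>\<^sub>E {..<m}" "\<And>i S. i \<in> I \<Longrightarrow> S \<in> Ss \<Longrightarrow> \<phi> \<notin> bad i S" by fastforce
  show thesis
  proof (rule that[of \<phi>])
    show sub: "\<phi> ` V \<subseteq> {..<m}" using \<phi>(1) by auto
    fix i assume i: "i \<in> I"
    show "s \<le> card (\<phi> ` W i)"
    proof (rule ccontr)
      assume "\<not> ?thesis"
      then have "\<phi> ` W i \<in> Ss" using sub W[OF i] by (auto simp: Ss_def)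
      then show False using \<phi>(2)[OF i, of "\<phi> ` W i"] \<phi>(1) by (simp add: bad_def)
    qed
  qed
qed

section \<open>Collapsing the vertex set\<close>

lemma lin_inj_scale_rows:
  assumes "lin_inj D J x" "\<And>u. u \<in> D \<Longrightarrow> s u \<noteq> 0"
  shows "lin_inj D J (\<lambda>u j. x u j / s u)"
proof (rule lin_injI)
  fix y j assume y: "\<And>u. u \<in> D \<Longrightarrow> (\<Sum>j\<in>J. x u j / s u * y j) = 0" and "j \<in> J"
  have "(\<Sum>j\<in>J. x u j * y j) = 0" if "u \<in> D" for u
  proof -
    have "(\<Sum>j\<in>J. x u j / s u * y j) = (\<Sum>j\<in>J. x u j * y j) / s u"
      by (simp add: sum_divide_distrib)
    then show ?thesis using y[OF that] assms(2)[OF that] by simp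
  qed
  then show "y j = 0" using lin_injD[OF assms(1) _ \<open>j \<in> J\<close>] by blast
qed

text \<open>Expanding the left side, the cross terms come from the first \<open>d\<close>
  coordinates and the terms \<open>F . P\<close> and \<open>F' . P'\<close> from the last, where
  both rows are 1. So the rates of all pairs form \<open>P B^T + B P^T\<close>, where a row of
  \<open>B\<close> is \<open>- F\<close> followed by \<open>F . P\<close>.\<close>

lemma edge_rate_as_symmetric_product:
  fixes P F :: "nat \<Rightarrow> real" and d :: nat
  assumes "P d = 1" "P' d = 1"
  shows "(\<Sum>l<d. (P l - P' l) * (F l - F' l)) =
    (\<Sum>j\<le>d. P j * (if j < d then - F' j else \<Sum>l<d. F' l * P' l) +
             (if j < d then - F j else \<Sum>l<d. F l * P l) * P' j)"
proof -
  have "(\<Sum>j\<le>d. P j * (if j < d then - F' j else \<Sum>l<d. F' l * P' l) +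
             (if j < d then - F j else \<Sum>l<d. F l * P l) * P' j) =
     (\<Sum>l<d. - (P l * F' l) - F l * P' l) + (\<Sum>l<d. F' l * P' l) + (\<Sum>l<d. F l * P l)"
    using assms by (simp add: sum_atMost_split)
  also have "\<dots> = (\<Sum>l<d. (P l - P' l) * (F l - F' l))"
    unfolding sum.distrib[symmetric] by (intro sum.cong refl) (simp add: algebra_simps)
  finally show ?thesis by simp
qed

text \<open>Common neighbours enter twice: those of two vertices in one class force equal
  velocities, and those of a vertex with any other vertex show that its class is joined to all but
  at most \<open>d\<close> classes.\<close>

lemma collapsed_framework_infinitesimally_rigid:
  fixes d :: nat and x :: "nat \<Rightarrow> nat \<Rightarrow> real" and \<phi> :: "'a \<Rightarrow> nat" and E :: "('a \<times> 'a) set"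
  defines "p \<equiv> \<lambda>v i. x (\<phi> v) i / x (\<phi> v) d"
  assumes V: "finite V" "2 \<le> card V" and E: "E \<subseteq> V \<times> V" and d: "3 \<le> d"
    and \<phi>: "\<phi> ` V \<subseteq> {..<6 * d}"
    and spread: "\<And>u v. u \<in> V \<Longrightarrow> v \<in> V \<Longrightarrow> u \<noteq> v \<Longrightarrow>
      5 * d \<le> card (\<phi> ` {w. (u, w) \<in> E \<and> (v, w) \<in> E})"
    and ind: "algebraically_independent_over_rat ({..<6 * d} \<times> {..d}) (\<lambda>(c, j). x c j)"
    and nz: "\<And>c. c < 6 * d \<Longrightarrow> x c d \<noteq> 0"
  shows "lin_inj V {..d} (\<lambda>v. affine_row d (p v))"
    and "infinitesimal_motion d E p f \<Longrightarrow> trivial_motion_on d V p f"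
proof -
  define C where "C = \<phi> ` V"
  have finC: "finite C" using V by (simp add: C_def)
  have Cd: "c < 6 * d" if "c \<in> C" for c using that \<phi> by (auto simp: C_def)
  define P where "P c j = x c j / x c d" for c j
  have Pd: "P c d = 1" if "c \<in> C" for c using nz Cd that by (simp add: P_def)
  have indC: "algebraically_independent_over_rat (C \<times> {..d}) (\<lambda>(c, j). x c j)"
    by (rule algebraically_independent_subset[OF ind]) (auto simp: Cd)
  have injP: "lin_inj D {..d} P" if D: "D \<subseteq> C" "d < card D" for D
    unfolding P_def
    using D Cd finite_subset[OF D(1) finC]
    by (intro lin_inj_scale_rows[OF generic_rows_lin_inj[OF indC]] nz) auto
  have nbr: "\<phi> ` {w. (u, w) \<in> E \<and> (v, w) \<in> E} \<subseteq> C" for u v using E by (auto simp: C_def)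
  obtain u0 v0 where "u0 \<in> V" "v0 \<in> V" "u0 \<noteq> v0"
    using V by (metis card_le_Suc0_iff_eq not_less_eq_eq numeral_2_eq_2)
  then have cardC: "5 * d \<le> card C"
    using spread[of u0 v0] card_mono[OF finC nbr] by (meson order_trans)
  have injC: "lin_inj C {..d} P" using cardC d by (intro injP) auto
  have row: "affine_row d (p v) i = P (\<phi> v) i" if "v \<in> V" "i \<le> d" for v i
    using that Pd[of "\<phi> v"] by (auto simp: affine_row_def p_def P_def C_def)
  show injV: "lin_inj V {..d} (\<lambda>v. affine_row d (p v))"
  proof (rule lin_injI)
    fix y j assume y: "\<And>v. v \<in> V \<Longrightarrow> (\<Sum>j\<le>d. affine_row d (p v) j * y j) = 0" and j: "j \<in> {..d}"
    have "(\<Sum>j\<le>d. P c j * y j) = 0" if c: "c \<in> C" for c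
    proof -
      obtain v where v: "v \<in> V" "c = \<phi> v" using c by (auto simp: C_def)
      then show ?thesis using y[OF v(1)] by (simp add: row)
    qed
    then show "y j = 0" using lin_injD[OF injC _ j] by blast
  qed
  assume f: "infinitesimal_motion d E p f"
  have edge: "(\<Sum>l<d. (P (\<phi> u) l - P (\<phi> v) l) * (f u l - f v l)) = 0" if "(u, v) \<in> E" for u v
    using f that by (auto simp: infinitesimal_motion_def edge_rate_def p_def P_def)
  have const: "f u l = f v l" if uv: "u \<in> V" "v \<in> V" "\<phi> u = \<phi> v" and l: "l < d" for u v l
  proof (cases "u = v")
    case False
    define c where "c = \<phi> u"
    define g where "g l = f u l - f v l" for l
    define D where "D = insert c (\<phi> ` {w. (u, w) \<in> E \<and> (v, w) \<in> E})"
    have D: "D \<subseteq> C" using nbr uv by (auto simp: D_def c_def C_def)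
    have "card (\<phi> ` {w. (u, w) \<in> E \<and> (v, w) \<in> E}) \<le> card D"
      by (rule card_mono[OF finite_subset[OF D finC]]) (auto simp: D_def)
    then have "5 * d \<le> card D" using spread[OF uv(1,2) False] by linarith
    then have inj: "lin_inj D {..d} P" using D d by (intro injP) auto
    \<comment> \<open>The affine function \<open>g . (z - P c)\<close> of \<open>z\<close> in
      homogeneous coordinates. It vanishes at \<open>c\<close> trivially, and at the class of a
      common neighbour by subtracting two edge equations; on more than \<open>d\<close> generic
      points only the zero function does so.\<close>
    define y where "y j = (if j < d then g j else - (\<Sum>l<d. P c l * g l))" for j
    have "(\<Sum>j\<le>d. P c' j * y j) = 0" if c': "c' \<in> D" for c'
    proof -
      have "(\<Sum>l<d. P c' l * g l) - (\<Sum>l<d. P c l * g l) = 0"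
      proof (cases "c' = c")
        case False
        then obtain w where w: "c' = \<phi> w" "(u, w) \<in> E" "(v, w) \<in> E" using c' by (auto simp: D_def)
        have "(\<Sum>l<d. P c' l * g l) - (\<Sum>l<d. P c l * g l) =
          (\<Sum>l<d. (P c l - P c' l) * (f v l - f w l)) - (\<Sum>l<d. (P c l - P c' l) * (f u l - f w l))"
          unfolding sum_subtractf[symmetric] by (intro sum.cong refl) (simp add: g_def algebra_simps)
        then show ?thesis using edge[OF w(2)] edge[OF w(3)] uv(3) by (simp add: w(1) c_def)
      qed simp
      then show ?thesis using c' D by (simp add: sum_atMost_split y_def Pd subset_iff)
    qed
    then have "y l = 0" using lin_injD[OF inj, of y l] l by simp
    then show ?thesis using l by (simp add: y_def g_def)
  qed simp
  define r where "r c = (SOME v. v \<in> V \<and> \<phi> v = c)" for c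
  have r: "r c \<in> V" "\<phi> (r c) = c" if "c \<in> C" for c
    using someI_ex[of "\<lambda>v. v \<in> V \<and> \<phi> v = c"] that by (auto simp: r_def C_def)
  define F where "F c = f (r c)" for c
  have fF: "f v l = F (\<phi> v) l" if "v \<in> V" "l < d" for v l
    unfolding F_def using that r[of "\<phi> v"] by (intro const) (auto simp: C_def)
  define B where "B c j = (if j < d then - F c j else \<Sum>l<d. F c l * P c l)" for c j
  define N where "N c c' = (\<Sum>j\<le>d. P c j * B c' j + B c j * P c' j)" for c c'
  have N: "N c c' = (\<Sum>l<d. (P c l - P c' l) * (F c l - F c' l))" if "c \<in> C" "c' \<in> C" for c c'
    unfolding N_def B_def
    by (rule edge_rate_as_symmetric_product[where P = "P c" and P' = "P c'" and d = d,
        OF Pd[OF that(1)] Pd[OF that(2)], symmetric])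
  define H where "H c = {c' \<in> C. N c c' \<noteq> 0}" for c
  have H: "finite (H c) \<and> card (H c) \<le> d" if c: "c \<in> C" for c
  proof -
    define u where "u = r c"
    have u: "u \<in> V" "\<phi> u = c" using r[OF c] by (auto simp: u_def)
    \<comment> \<open>Any second vertex serves, since its common neighbours with \<open>u\<close>
      are in particular neighbours of \<open>u\<close>.\<close>
    obtain v where v: "v \<in> V" "v \<noteq> u" using \<open>u0 \<in> V\<close> \<open>v0 \<in> V\<close> \<open>u0 \<noteq> v0\<close> by metis
    define A where "A = \<phi> ` {w. (u, w) \<in> E \<and> (v, w) \<in> E}"
    have A: "A \<subseteq> {..<6 * d}" "5 * d \<le> card A"
      using nbr[of u v] Cd spread[OF u(1) v(1)] v(2) by (auto simp: A_def)
    have "H c \<subseteq> {..<6 * d} - A"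
    proof
      fix c' assume c': "c' \<in> H c"
      have "c' \<notin> A"
      proof
        assume "c' \<in> A"
        then obtain w where w: "c' = \<phi> w" "(u, w) \<in> E" by (auto simp: A_def)
        have wV: "w \<in> V" using w(2) E by auto
        have "N c c' = (\<Sum>l<d. (P (\<phi> u) l - P (\<phi> w) l) * (f u l - f w l))"
          using c' c by (simp add: N H_def fF u wV w(1))
        then show False using edge[OF w(2)] c' by (simp add: H_def)
      qed
      then show "c' \<in> {..<6 * d} - A" using c' Cd by (auto simp: H_def)
    qed
    then have "card (H c) \<le> card ({..<6 * d} - A)" by (intro card_mono) auto
    also have "\<dots> = 6 * d - card A" using A finite_subset[OF A(1)] by (simp add: card_Diff_subset)
    finally show ?thesis using A finC by (auto simp: H_def)
  qed
  define s where "s c = x c d" for c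
  have s: "s c \<noteq> 0" "x c j = s c * P c j" if "c \<in> C" for c j
    using nz[OF Cd[OF that]] by (auto simp: s_def P_def)
  \<comment> \<open>Undoing the scaling multiplies \<open>N c c'\<close> by
    \<open>s c * s c'\<close>: the zeros stay, while all \<open>d + 1\<close> coordinates become
    independent.\<close>
  define B' where "B' c j = s c * B c j" for c j
  have M: "(\<Sum>j\<le>d. x c j * B' c' j + B' c j * x c' j) = s c * s c' * N c c'" if "c \<in> C" "c' \<in> C" for c c'
    unfolding N_def sum_distrib_left
    by (intro sum.cong refl) (simp add: s(2)[OF that(1)] s(2)[OF that(2)] B'_def algebra_simps)
  have "N c c' = 0" if cc: "c \<in> C" "c' \<in> C" for c c'
  proof -
    have "(\<Sum>j\<le>d. x c j * B' c' j + B' c j * x c' j) = 0"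
    proof (rule generic_sparse_product_zero[OF indC finC _ H _ cc])
      show "(\<Sum>j\<le>d. x u j * B' v j + B' u j * x v j) = 0" if "u \<in> C" "v \<in> C" "v \<notin> H u" for u v
        using that by (simp add: M H_def)
      \<comment> \<open>With \<open>5 * d\<close> classes this is where \<open>d \<ge> 3\<close> is
        needed.\<close>
      show "2 * d + 2 * d + 2 < card C" using cardC d by simp
    qed
    then show ?thesis using M[OF cc] s(1) cc by simp
  qed
  then obtain A where A: "\<And>i j. i \<in> {..d} \<Longrightarrow> j \<in> {..d} \<Longrightarrow> A i j = - A j i"
    "\<And>c j. c \<in> C \<Longrightarrow> j \<in> {..d} \<Longrightarrow> B c j = (\<Sum>i\<le>d. P c i * A i j)"
    using skew_symmetric_if_product_zero[OF finC finite_atMost injC, of B] unfolding N_def by blast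
  show "trivial_motion_on d V p f"
    unfolding trivial_motion_on_def
  \<comment> \<open>The sign undoes the one in \<open>B\<close>, which carries
    \<open>- F\<close>.\<close>
  proof (intro exI[of _ "\<lambda>i j. - A i j"] conjI ballI allI impI)
    fix i j assume "i \<le> d" "j \<le> d"
    then show "- A i j = - (- A j i)" using A(1)[of i j] by simp
  next
    fix v l assume v: "v \<in> V" and l: "l < d"
    have "f v l = - B (\<phi> v) l" using fF[OF v l] l by (simp add: B_def)
    also have "\<dots> = - (\<Sum>i\<le>d. P (\<phi> v) i * A i l)" using A(2)[of "\<phi> v" l] v l by (simp add: C_def)
    also have "\<dots> = (\<Sum>i\<le>d. affine_row d (p v) i * - A i l)"
      using v by (simp add: row sum_negf)
    finally show "f v l = (\<Sum>i\<le>d. affine_row d (p v) i * - A i l)" .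
  qed
qed

text \<open>The given placement may be degenerate, with coinciding vertices, but exactness holds on
  a neighbourhood and this contains generic points. Affine spanning is carried along because the
  passage to continuous motions uses it again.\<close>

lemma rigid_graph_if_infinitesimally_rigid:
  assumes V: "finite (pverts G)" and E: "parcs G \<subseteq> pverts G \<times> pverts G"
    and exact: "\<And>f. infinitesimal_motion d (parcs G) p f \<Longrightarrow> trivial_motion_on d (pverts G) p f"
    and inj: "lin_inj (pverts G) {..d} (\<lambda>v. affine_row d (p v))"
  shows "rigid_graph d G"
proof -
  obtain \<eta> where \<eta>: "\<eta> > 0"
    "\<And>x. (\<forall>v\<in>pverts G. \<forall>i<d. \<bar>x v i - p v i\<bar> < \<eta>) \<Longrightarrow> lin_inj (pverts G) {..d} (\<lambda>v. affine_row d (x v))"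
    "\<And>x f. (\<forall>v\<in>pverts G. \<forall>i<d. \<bar>x v i - p v i\<bar> < \<eta>) \<Longrightarrow> infinitesimal_motion d (parcs G) x f \<Longrightarrow>
      trivial_motion_on d (pverts G) x f"
    by (rule infinitesimal_rigidity_open[OF V E exact inj]) blast+
  have "finite (pverts G \<times> {..<d})" using V by simp
  then obtain a where a: "algebraically_independent_over_rat (pverts G \<times> {..<d}) a"
    "\<And>c. c \<in> pverts G \<times> {..<d} \<Longrightarrow> \<bar>a c - p (fst c) (snd c)\<bar> < \<eta>"
    using algebraically_independent_near[OF _ \<eta>(1), of _ "\<lambda>c. p (fst c) (snd c)"] by blast
  define x where "x v i = a (v, i)" for v i
  have near: "\<forall>v\<in>pverts G. \<forall>i<d. \<bar>x v i - p v i\<bar> < \<eta>" using a(2) by (force simp: x_def)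
  have "(\<lambda>(v, i). x v i) = a" by (auto simp: x_def)
  then have "generic d G x" using a(1) by (simp add: generic_def)
  moreover have "rigid_framework d G x"
    using rigid_framework_if_infinitesimally_rigid[OF V E \<eta>(3)[OF near] \<eta>(2)[OF near]] by blast
  ultimately show ?thesis unfolding rigid_graph_def by blast
qed

section \<open>Numerical estimate and conclusion\<close>

text \<open>The three factors are at most the exponentials of \<open>2 k / 65\<close>, of
  \<open>5 k / 48\<close> (from \<open>ln 2 \<le> 25 / 36\<close>) and of \<open>- k / 6\<close>
  (from \<open>5 / 6 \<le> exp (- 1 / 6)\<close>). The exponents add up to
  \<open>(2 / 65 - 1 / 16) k\<close>, which is negative.\<close>

lemma union_bound_numeric:
  fixes k :: real
  assumes n: "2 \<le> n" and k: "65 * ln (real n) \<le> k" and d: "real d \<le> k / 40" and \<kappa>: "k \<le> real \<kappa>"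
  shows "real (n\<^sup>2) * 2 ^ (6 * d) * (5 / 6) ^ \<kappa> < 1"
proof -
  have ln_n: "ln (real n) > 0" using n by simp
  have "real (n\<^sup>2) = exp (2 * ln (real n))"
    using n by (simp add: exp_double)
  also have "\<dots> \<le> exp (2 * k / 65)" using k by simp
  finally have 1: "real (n\<^sup>2) \<le> exp (2 * k / 65)" .
  have "(2::real) ^ (6 * d) = exp (6 * real d * ln 2)"
    using exp_of_nat_mult[of "6 * d" "ln 2 :: real"] by simp
  also have "\<dots> \<le> exp (6 * (k / 40) * (25 / 36))"
  proof -
    have "6 * real d * ln 2 \<le> 6 * (k / 40) * (25 / 36 :: real)"
      using d ln2_le_25_over_36 by (intro mult_mono) auto
    then show ?thesis by simp
  qed
  finally have 2: "(2::real) ^ (6 * d) \<le> exp (6 * (k / 40) * (25 / 36))" .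
  have "(5 / 6 :: real) \<le> exp (- (1 / 6))" using exp_ge_add_one_self[of "- (1 / 6) :: real"] by simp
  then have "(5 / 6 :: real) ^ \<kappa> \<le> exp (- (1 / 6)) ^ \<kappa>" by (intro power_mono) auto
  also have "\<dots> = exp (- real \<kappa> / 6)" by (simp flip: exp_of_nat_mult)
  also have "\<dots> \<le> exp (- k / 6)" using \<kappa> by simp
  finally have 3: "(5 / 6 :: real) ^ \<kappa> \<le> exp (- k / 6)" .
  have "real (n\<^sup>2) * 2 ^ (6 * d) * (5 / 6) ^ \<kappa> \<le>
      exp (2 * k / 65) * exp (6 * (k / 40) * (25 / 36)) * exp (- k / 6)"
    by (intro mult_mono 1 2 3) auto
  also have "\<dots> = exp (2 * k / 65 + 6 * (k / 40) * (25 / 36) + - k / 6)"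
    by (simp only: exp_add)
  also have "\<dots> < 1" using k ln_n by (simp add: field_simps)
  finally show ?thesis .
qed

theorem theorem1p4:
  shows "\<exists>n\<^sub>0::nat. n\<^sub>0 > 0 \<and>
    (\<forall>n\<ge>n\<^sub>0. \<forall>k::real. k \<ge> 65 * ln (real n) \<longrightarrow>
      (\<forall>G::'a pair_pre_digraph.
         pair_graph G \<and> card (pverts G) = n \<and> real (min_codegree G) \<ge> k \<longrightarrow>
         rigid_graph (nat \<lfloor>k / 40\<rfloor>) G))"
proof (intro exI[of _ 8] conjI allI impI)
  show "(0::nat) < 8" by simp
  fix n :: nat and k :: real and G :: "'a pair_pre_digraph"
  assume n: "8 \<le> n" and k: "65 * ln (real n) \<le> k"
    and G: "pair_graph G \<and> card (pverts G) = n \<and> k \<le> real (min_codegree G)"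
  interpret pair_graph G using G by simp
  define V where "V = pverts G"
  define E where "E = parcs G"
  define \<kappa> where "\<kappa> = min_codegree G"
  define d where "d = nat \<lfloor>k / 40\<rfloor>"
  have V: "finite V" "card V = n" using G pair_finite_verts by (auto simp: V_def)
  have E: "E \<subseteq> V \<times> V" using in_arcsD1 in_arcsD2 by (auto simp: E_def V_def)
  \<comment> \<open>The threshold 8 gives \<open>ln n \<ge> 3 * ln 2 \<ge> 2\<close>, hence
    \<open>k / 40 \<ge> 130 / 40 > 3\<close> and \<open>d \<ge> 3\<close>.\<close>
  have "ln 8 \<le> ln (real n)" using n by simp
  moreover have "ln (8::real) = 3 * ln 2" using ln_realpow[of 2 3] by simp
  moreover have "2 / 3 \<le> ln (2::real)" using ln2_ge_two_thirds by simp
  ultimately have "2 \<le> ln (real n)" by linarith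
  then have k40: "3 \<le> k / 40" using k by simp
  then have d3: "3 \<le> d" unfolding d_def by linarith
  have dk: "real d \<le> k / 40" unfolding d_def using k40 by linarith
  define I where "I = {(u, v). u \<in> V \<and> v \<in> V \<and> u \<noteq> v}"
  define W where "W e = {w. (fst e, w) \<in> E \<and> (snd e, w) \<in> E}" for e
  have IV: "I \<subseteq> V \<times> V" by (auto simp: I_def)
  have finI: "finite I" by (rule finite_subset[OF IV]) (simp add: V)
  have cardI: "card I \<le> n\<^sup>2"
    using card_mono[OF _ IV] V by (simp add: card_cartesian_product power2_eq_square)
  have W: "W e \<subseteq> V \<and> \<kappa> \<le> card (W e)" if e: "e \<in> I" for e
  proof
    show "W e \<subseteq> V" using E by (auto simp: W_def)
    let ?S = "{codegree G u v | u v. u \<in> pverts G \<and> v \<in> pverts G \<and> u \<noteq> v}"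
    have S: "?S = (\<lambda>(u, v). codegree G u v) ` I" by (auto simp: I_def V_def)
    have "codegree G (fst e) (snd e) \<in> ?S" unfolding S using e by (auto simp: case_prod_unfold)
    then have "\<kappa> \<le> codegree G (fst e) (snd e)"
      unfolding \<kappa>_def min_codegree_def by (rule Min_le[rotated]) (simp only: S finite_imageI finI)
    also have "\<dots> = card (W e)"
      by (simp add: codegree_def neighbourhood_def W_def E_def Collect_conj_eq)
    finally show "\<kappa> \<le> card (W e)" .
  qed
  have small: "real (card I) * 2 ^ (6 * d) * (real (5 * d) / real (6 * d)) ^ \<kappa> < 1"
  proof -
    have "real (card I) * 2 ^ (6 * d) * (real (5 * d) / real (6 * d)) ^ \<kappa> \<le>
        real (n\<^sup>2) * 2 ^ (6 * d) * (5 / 6) ^ \<kappa>"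
      using cardI d3 by (intro mult_mono) (auto simp del: of_nat_power)
    also have "\<dots> < 1" using n k dk G by (intro union_bound_numeric) (auto simp: \<kappa>_def)
    finally show ?thesis .
  qed
  obtain \<phi> where \<phi>: "\<phi> ` V \<subseteq> {..<6 * d}" "\<And>e. e \<in> I \<Longrightarrow> 5 * d \<le> card (\<phi> ` W e)"
    by (rule ex_map_with_large_images[OF V(1) finI W _ _ small]) (use d3 in auto)
  \<comment> \<open>Centre 1 and radius 1 keep every coordinate positive, so that dividing by the
    last one is legitimate.\<close>
  have "finite ({..<6 * d} \<times> {..d})" by simp
  then obtain a where a: "algebraically_independent_over_rat ({..<6 * d} \<times> {..d}) a"
    "\<And>c. c \<in> {..<6 * d} \<times> {..d} \<Longrightarrow> \<bar>a c - 1\<bar> < 1"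
    using algebraically_independent_near[of _ 1 "\<lambda>_. 1"] by (metis zero_less_one)
  define x where "x c j = a (c, j)" for c j
  have ind: "algebraically_independent_over_rat ({..<6 * d} \<times> {..d}) (\<lambda>(c, j). x c j)"
    using a(1) by (simp add: x_def)
  have nz: "x c d \<noteq> 0" if "c < 6 * d" for c using a(2)[of "(c, d)"] that by (auto simp: x_def)
  have spread: "5 * d \<le> card (\<phi> ` {w. (u, w) \<in> E \<and> (v, w) \<in> E})" if "u \<in> V" "v \<in> V" "u \<noteq> v" for u v
    using \<phi>(2)[of "(u, v)"] that by (simp add: I_def W_def)
  have V2: "2 \<le> card V" using V n by simp
  note rigid = collapsed_framework_infinitesimally_rigid[OF V(1) V2 E d3 \<phi>(1) spread ind nz]
  show "rigid_graph (nat \<lfloor>k / 40\<rfloor>) G"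
    unfolding d_def[symmetric]
    using rigid_graph_if_infinitesimally_rigid[OF V(1)[unfolded V_def] E[unfolded V_def E_def]
        rigid(2)[unfolded V_def E_def] rigid(1)[unfolded V_def]] by blast
qed

end
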